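(* Let $A \subset \mathbb{R}$ be finite. Then $$|A(A-A)| \gtrsim |A|^{\frac{3}{2}+\frac{1}{34}}.$$
   Context: $A-A=\{a-b: a,b\in A\}$ and $A(A-A)=\{a(b-c): a,b,c\in A\}$. Notation: $X \ll Y$ (equivalently $Y\gg X$) means $X\le cY$ for an absolute constant $c>0$. $X \gtrsim Y$ means there is an absolute constant $c>0$ such that $X \gg Y/(\log X)^c$. Logarithms are base 2. *)

theory Defs
  imports Complex_Main
begin

definition diffset :: "real set \<Rightarrow> real set" where
  "diffset A = {a - b | a b. a \<in> A \<and> b \<in> A}"

definition prod_diffset :: "real set \<Rightarrow> real set" where
  "prod_diffset A = {a * (b - c) | a b c. a \<in> A \<and> b \<in> A \<and> c \<in> A}"

end

theory Submission
  imports Defs "HOL-Analysis.Convex"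
begin

text \<open>
  Write \<open>D = A - A\<close>, \<open>P = A(A - A)\<close> and ignore constants and logarithms.
  For lines with nonzero slope and a Cartesian product \<open>X \<times> Y\<close>, the Szemeredi--Trotter bound
  follows by cutting \<open>X\<close> and \<open>Y\<close> into blocks of consecutive elements: a line is monotone, so it
  meets few of the resulting cells, and two distinct points in one cell determine a line.

  The number of solutions of \<open>a(b - c) = a'(b' - c')\<close> is at least \<open>|A|^6 / |P|\<close>. Sorting by the ratio
  \<open>a'/a\<close> and bounding the energies \<open>E(A, xA)\<close> by Szemeredi--Trotter gives a set \<open>M\<close> of ratios, each
  with at least \<open>\<tau>\<close> representations, such that \<open>\<tau>^2 |M| \<ge> |A|^6 / |P|^2\<close>. Hence there is \<open>B \<subseteq> A\<close> all
  of whose elements have at least \<open>s\<close> representations as a product in \<open>M A\<close>, where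
  \<open>s |B| \<ge> \<tau> |M|\<close>.

  A set whose elements have many representations as products \<open>q r\<close> has few popular differences
  with any other set, again by Szemeredi--Trotter with lines \<open>y = q x - c\<close>. For \<open>B \<subseteq> M A\<close> this bounds
  the third energy of \<open>B\<close>; for \<open>D \<subseteq> A^{-1} P\<close> it bounds \<open>E(D, B)\<close>. The Katz--Koester inclusion
  \<open>B - (B \<inter> (B - x)) \<subseteq> D \<inter> (D + x)\<close> and Cauchy--Schwarz bound \<open>|B|^6\<close> by the product of the two
  energies divided by the multiplicity \<open>|B|^2 / |P|\<close> of a typical difference. Altogether
  \<open>|A|^23 \<le> |P|^15\<close>, and \<open>23/15 > 26/17 = 3/2 + 1/34\<close>.
\<close>

section \<open>Incidences of lines with a Cartesian product\<close>

text \<open>One preimage is chosen for each value of \<open>c\<close>. Every other point of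
  \<open>H\<close> collides with the chosen point of its value.\<close>

lemma card_le_card_image_plus_collisions:
  assumes "finite H"
  shows "card H \<le> card (c ` H) + card {(x, x'). x \<in> H \<and> x' \<in> H \<and> x \<noteq> x' \<and> c x = c x'}"
    (is "_ \<le> _ + card ?C")
proof -
  have fC: "finite ?C"
    by (rule finite_subset[of _ "H \<times> H"]) (use assms in auto)
  have "H \<subseteq> inv_into H c ` (c ` H) \<union> fst ` ?C"
  proof
    fix x assume x: "x \<in> H"
    let ?y = "inv_into H c (c x)"
    have y: "?y \<in> H" "c ?y = c x"
      by (rule inv_into_into[OF imageI[OF x]], rule f_inv_into_f[OF imageI[OF x]])
    show "x \<in> inv_into H c ` (c ` H) \<union> fst ` ?C"
    proof (cases "?y = x")
      case True
      then show ?thesis using x by (intro UnI1 image_eqI[of _ _ "c x"]) auto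
    next
      case False
      then have "(x, ?y) \<in> ?C" using x y by auto
      then show ?thesis by force
    qed
  qed
  then have "card H \<le> card (inv_into H c ` (c ` H) \<union> fst ` ?C)"
    using assms fC by (intro card_mono) auto
  also have "\<dots> \<le> card (inv_into H c ` (c ` H)) + card (fst ` ?C)"
    by (rule card_Un_le)
  also have "\<dots> \<le> card (c ` H) + card ?C"
    using assms fC by (intro add_mono card_image_le) auto
  finally show ?thesis .
qed

text \<open>Along \<open>H\<close> both coordinates can only grow, so two pairs with the same
  coordinate sum coincide, and the sum takes values in \<open>{..M + N}\<close>.\<close>

lemma card_monotone_chain_le:
  fixes H :: "'a::linorder set" and f g :: "'a \<Rightarrow> nat"
  assumes "mono_on H f" "mono_on H g"
    and "\<And>x. x \<in> H \<Longrightarrow> f x \<le> M" "\<And>x. x \<in> H \<Longrightarrow> g x \<le> N"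
  shows "card ((\<lambda>x. (f x, g x)) ` H) \<le> M + N + 1"
proof -
  have "inj_on (\<lambda>(i, j). i + j) ((\<lambda>x. (f x, g x)) ` H)"
  proof (rule inj_onI, clarsimp)
    fix x y assume xy: "x \<in> H" "y \<in> H" "f x + g x = f y + g y"
    show "f x = f y \<and> g x = g y"
    proof (cases "x \<le> y")
      case True
      then have "f x \<le> f y" "g x \<le> g y" using assms xy by (auto simp: mono_on_def)
      then show ?thesis using xy by linarith
    next
      case False
      then have "f y \<le> f x" "g y \<le> g x" using assms xy by (auto simp: mono_on_def)
      then show ?thesis using xy by linarith
    qed
  qed
  then have "card ((\<lambda>x. (f x, g x)) ` H) = card ((\<lambda>(i, j). i + j) ` (\<lambda>x. (f x, g x)) ` H)"
    by (simp add: card_image)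
  also have "\<dots> \<le> card {..M + N}"
    using assms(3,4) by (intro card_mono) (auto intro: add_mono)
  finally show ?thesis by simp
qed

section \<open>Cells of a grid cut into blocks of consecutive elements\<close>

definition block :: "'a::linorder set \<Rightarrow> nat \<Rightarrow> 'a \<Rightarrow> nat" where
  "block X w x = card {x' \<in> X. x' < x} div w"

lemma block_mono:
  assumes "finite X" "x \<le> y"
  shows "block X w x \<le> block X w y"
  unfolding block_def using assms by (intro div_le_mono card_mono) auto

lemma block_le:
  assumes "finite X"
  shows "block X w x \<le> card X div w"
  unfolding block_def using assms by (intro div_le_mono card_mono) auto

text \<open>The rank, that is the number of smaller elements, is injective on \<open>X\<close>, and
  on block \<open>i\<close> it lies in an interval of length \<open>w\<close>.\<close>

lemma card_block_le:
  assumes "finite X" "w > 0"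
  shows "card {x \<in> X. block X w x = i} \<le> w"
proof -
  let ?r = "\<lambda>x. card {x' \<in> X. x' < x}"
  have "strict_mono_on X ?r"
  proof (rule strict_mono_onI)
    fix r s assume "r \<in> X" "s \<in> X" "r < s"
    then show "?r r < ?r s"
      using assms by (intro psubset_card_mono) auto
  qed
  then have "inj_on ?r X" by (rule strict_mono_on_imp_inj_on)
  then have "inj_on ?r {x \<in> X. block X w x = i}" by (rule inj_on_subset) auto
  then have "card {x \<in> X. block X w x = i} = card (?r ` {x \<in> X. block X w x = i})"
    by (simp add: card_image)
  also have "\<dots> \<le> card {i * w..<i * w + w}"
  proof (rule card_mono)
    show "?r ` {x \<in> X. block X w x = i} \<subseteq> {i * w..<i * w + w}"
      using assms
      by (auto simp: block_def) (metis add.commute dividend_less_div_times)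
  qed simp
  finally show ?thesis by simp
qed

text \<open>The pair \<open>(m, k)\<close> stands for the line y = m x + k. An incident point is
  recorded by its abscissa alone, since the line determines the ordinate.\<close>

definition incidences :: "real set \<Rightarrow> real set \<Rightarrow> (real \<times> real) set \<Rightarrow> ((real \<times> real) \<times> real) set"
  where "incidences X Y L = {((m, k), x). (m, k) \<in> L \<and> x \<in> X \<and> m * x + k \<in> Y}"

lemma finite_incidences [simp]:
  assumes "finite X" "finite L"
  shows "finite (incidences X Y L)"
  by (rule finite_subset[of _ "L \<times> X"]) (use assms in \<open>auto simp: incidences_def\<close>)

lemma incidences_eq_Sigma:
  "incidences X Y L = Sigma L (\<lambda>l. {x \<in> X. fst l * x + snd l \<in> Y})"
  by (auto simp: incidences_def)

text \<open>A line of nonzero slope is a monotone graph, so the cells it visits form a monotone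
  chain.\<close>

lemma card_line_cells_le:
  fixes X Y :: "real set"
  assumes "finite X" "finite Y" "m \<noteq> 0"
  shows "card ((\<lambda>x. (block X w x, block Y v (m * x + k))) ` {x \<in> X. m * x + k \<in> Y})
    \<le> card X div w + card Y div v + 1" (is "card (?c ` ?H) \<le> _")
proof (cases "m > 0")
  case True
  show ?thesis
    using assms True
    by (intro card_monotone_chain_le) (auto simp: mono_on_def block_le intro!: block_mono mult_left_mono)
next
  case False
  let ?N = "card Y div v"
  \<comment> \<open>For negative slope the second index decreases, and reflecting it in
    \<open>?N\<close> makes it increase. The truncated subtraction loses nothing because block
    indices are at most \<open>?N\<close>.\<close>
  let ?c' = "\<lambda>x. (block X w x, ?N - block Y v (m * x + k))"
  have "?c ` ?H = (\<lambda>(i, j). (i, ?N - j)) ` ?c' ` ?H"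
    using block_le[OF assms(2), of v] by (auto simp: image_image intro!: image_cong)
  then have "card (?c ` ?H) \<le> card (?c' ` ?H)"
    using assms by (simp add: card_image_le)
  also have "\<dots> \<le> card X div w + ?N + 1"
    using assms False
    by (intro card_monotone_chain_le)
       (auto simp: mono_on_def block_le intro!: block_mono diff_le_mono2 mult_left_mono_neg)
  finally show ?thesis .
qed

text \<open>On each line the points are counted by the cells they occupy plus the ordered pairs of
  distinct points sharing a cell. Two distinct points determine the line, so over all of
  \<open>L\<close> these pairs number at most the pairs of grid points in a common cell.\<close>

lemma card_incidences_block_bound:
  assumes fin: "finite X" "finite Y" "finite L" and nz: "\<And>l. l \<in> L \<Longrightarrow> fst l \<noteq> 0"
    and w: "w > 0" and v: "v > 0"
  shows "card (incidences X Y L)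
    \<le> card L * (card X div w + card Y div v + 1) + card X * card Y * (w * v)"
proof -
  let ?H = "\<lambda>l. {x \<in> X. fst l * x + snd l \<in> Y}"
  let ?c = "\<lambda>l x. (block X w x, block Y v (fst l * x + snd l))"
  let ?C = "\<lambda>l. {(x, x'). x \<in> ?H l \<and> x' \<in> ?H l \<and> x \<noteq> x' \<and> ?c l x = ?c l x'}"
  let ?T = "Sigma (X \<times> Y) (\<lambda>p. {x \<in> X. block X w x = block X w (fst p)} \<times>
      {y \<in> Y. block Y v y = block Y v (snd p)})"
  have finC: "finite (?C l)" for l
    by (rule finite_subset[of _ "X \<times> X"]) (use fin in auto)
  have "card (Sigma L ?C) \<le> card ?T"
  proof (rule card_inj_on_le)
    let ?h = "\<lambda>(l, x, x'). ((x, fst l * x + snd l), (x' :: real, fst l * x' + snd l :: real))"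
    show "inj_on ?h (Sigma L ?C)"
    proof (rule inj_onI, clarsimp)
      fix m k m' k' x x' :: real
      assume "x \<noteq> x'" and e: "m * x + k = m' * x + k'" "m * x' + k = m' * x' + k'"
      have "(m - m') * (x - x') = 0" using e by (simp add: algebra_simps)
      then have "m = m'" using \<open>x \<noteq> x'\<close> by simp
      then show "m = m' \<and> k = k'" using e by simp
    qed
    show "?h ` Sigma L ?C \<subseteq> ?T" by auto
    show "finite ?T" using fin by auto
  qed
  also have "card ?T = (\<Sum>p\<in>X \<times> Y. card {x \<in> X. block X w x = block X w (fst p)} *
      card {y \<in> Y. block Y v y = block Y v (snd p)})"
    using fin by (subst card_SigmaI) (auto simp: card_cartesian_product)
  also have "\<dots> \<le> (\<Sum>p\<in>X \<times> Y. w * v)"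
    using fin w v by (intro sum_mono mult_mono card_block_le) auto
  also have "\<dots> = card X * card Y * (w * v)" by (simp add: card_cartesian_product)
  finally have pairs: "(\<Sum>l\<in>L. card (?C l)) \<le> card X * card Y * (w * v)"
    using fin finC by simp
  have "card (incidences X Y L) = (\<Sum>l\<in>L. card (?H l))"
    unfolding incidences_eq_Sigma using fin by (subst card_SigmaI) auto
  also have "\<dots> \<le> (\<Sum>l\<in>L. card (?c l ` ?H l) + card (?C l))"
    using fin by (intro sum_mono card_le_card_image_plus_collisions) auto
  also have "\<dots> \<le> (\<Sum>l\<in>L. card X div w + card Y div v + 1 + card (?C l))"
    using fin nz by (intro sum_mono add_right_mono card_line_cells_le) auto
  also have "\<dots> = card L * (card X div w + card Y div v + 1) + (\<Sum>l\<in>L. card (?C l))"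
    unfolding sum.distrib by (simp only: sum_constant of_nat_id distrib_left)
  also have "\<dots> \<le> card L * (card X div w + card Y div v + 1) + card X * card Y * (w * v)"
    using pairs by (rule add_left_mono)
  finally show ?thesis .
qed

text \<open>A line of nonzero slope has at most one point at each abscissa and at most one at each
  height.\<close>

lemma card_incidences_le_points:
  assumes fin: "finite X" "finite Y" "finite L" and nz: "\<And>l. l \<in> L \<Longrightarrow> fst l \<noteq> 0"
  shows "card (incidences X Y L) \<le> card L * card X" "card (incidences X Y L) \<le> card L * card Y"
proof -
  have "card (incidences X Y L) \<le> card (L \<times> X)"
    using fin by (intro card_mono) (auto simp: incidences_def)
  then show "card (incidences X Y L) \<le> card L * card X" by (simp add: card_cartesian_product)
  have nz': "(0, k) \<notin> L" for k using nz[of "(0, k)"] by auto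
  have "card (incidences X Y L) \<le> card (L \<times> Y)"
  proof (rule card_inj_on_le)
    show "inj_on (\<lambda>(l, x). (l, fst l * x + snd l)) (incidences X Y L)"
      using nz' by (auto simp: inj_on_def incidences_def)
    show "(\<lambda>(l, x). (l, fst l * x + snd l)) ` incidences X Y L \<subseteq> L \<times> Y"
      by (auto simp: incidences_def)
    show "finite (L \<times> Y)" using fin by simp
  qed
  then show "card (incidences X Y L) \<le> card L * card Y" by (simp add: card_cartesian_product)
qed

text \<open>The block bound is optimised over the block sizes. The second alternative absorbs the
  \<open>+ 1\<close> in the number of cells met by a line.\<close>

theorem szemeredi_trotter_cartesian:
  assumes fin: "finite X" "finite Y" "finite L" and nz: "\<And>l. l \<in> L \<Longrightarrow> fst l \<noteq> 0"
  shows "real (card (incidences X Y L)) ^ 3 \<le> 1000 * (real (card L) * real (card X) * real (card Y))\<^sup>2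
    \<or> card (incidences X Y L) \<le> 4 * card L"
proof -
  define I l x y where "I = real (card (incidences X Y L))" and "l = real (card L)"
    and "x = real (card X)" and "y = real (card Y)"
  have le: "I \<le> l * x" "I \<le> l * y"
    unfolding I_def l_def x_def y_def of_nat_mult[symmetric] of_nat_le_iff
    by (intro card_incidences_le_points fin nz; assumption)+
  have nn: "I \<ge> 0" "l \<ge> 0" "x \<ge> 0" "y \<ge> 0" by (auto simp: I_def l_def x_def y_def)
  have "I ^ 3 \<le> 1000 * (l * x * y)\<^sup>2 \<or> I \<le> 4 * l"
  proof (cases "l = 0 \<or> x = 0 \<or> y = 0")
    case True
    then have "I = 0" using le nn by auto
    then show ?thesis using nn by auto
  next
    case False
    then have pos: "l > 0" "x > 0" "y > 0" using nn by auto
    \<comment> \<open>With block sizes \<open>x / r\<close> and \<open>y / r\<close> the cell term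
      is about \<open>l * r\<close> and the collision term about \<open>(x * y)^2 / r^2\<close>;
      this \<open>r\<close> makes the two equal.\<close>
    define r where "r = root 3 ((x * y)\<^sup>2 / l)"
    have r: "r > 0" "r ^ 3 = (x * y)\<^sup>2 / l"
      using pos by (auto simp: r_def real_root_gt_zero)
    have "I \<le> 5 * l * r + 2 * l"
    \<comment> \<open>If one of the intended block sizes is below 1, the trivial bound by points
      already gives \<open>l * r\<close>.\<close>
    proof (cases "x < r \<or> y < r")
      case True
      then have "I \<le> l * r" using le pos
        by (meson less_eq_real_def mult_left_mono order_trans)
      then show ?thesis using pos r by (auto intro: order_trans)
    next
      case F: False
      define w v where "w = nat \<lfloor>x / r\<rfloor>" and "v = nat \<lfloor>y / r\<rfloor>"
      have fl: "real (nat \<lfloor>z\<rfloor>) \<le> z \<and> z \<le> 2 * real (nat \<lfloor>z\<rfloor>) \<and> nat \<lfloor>z\<rfloor> > 0" if "z \<ge> 1" for z :: real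
      proof -
        have "\<lfloor>z\<rfloor> \<ge> 1" using that by simp
        moreover from this have "real (nat \<lfloor>z\<rfloor>) = of_int \<lfloor>z\<rfloor>" by simp
        ultimately show ?thesis by linarith
      qed
      have q: "x / r \<ge> 1" "y / r \<ge> 1" using F r by auto
      have w: "real w \<le> x / r" "x / r \<le> 2 * real w" "w > 0"
        unfolding w_def using fl[OF q(1)] by auto
      have v: "real v \<le> y / r" "y / r \<le> 2 * real v" "v > 0"
        unfolding v_def using fl[OF q(2)] by auto
      have "x / w \<le> 2 * r" "y / v \<le> 2 * r"
        using w v r by (auto simp: field_simps)
      moreover have "real (card X div w) \<le> x / w" "real (card Y div v) \<le> y / v"
        unfolding x_def y_def by (rule of_nat_div_le_of_nat)+
      ultimately have b: "real (card X div w + card Y div v + 1) \<le> 4 * r + 2" by simp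
      have "real w * real v \<le> x / r * (y / r)"
        using w v by (intro mult_mono) auto
      then have "x * y * (real w * real v) \<le> x * y * (x / r * (y / r))"
        using pos by (intro mult_left_mono) auto
      also have "\<dots> = (x * y)\<^sup>2 / r\<^sup>2"
        by (simp add: power2_eq_square)
      also have "(x * y)\<^sup>2 = l * r ^ 3" using r pos by simp
      also have "l * r ^ 3 / r\<^sup>2 = l * r" using r(1) by (simp add: power2_eq_square power3_eq_cube)
      finally have c: "x * y * (real w * real v) \<le> l * r" .
      have "I \<le> l * real (card X div w + card Y div v + 1) + x * y * (real w * real v)"
        using card_incidences_block_bound[OF fin nz w(3) v(3)]
        unfolding I_def l_def x_def y_def of_nat_mult[symmetric] of_nat_add[symmetric] of_nat_le_iff .
      also have "\<dots> \<le> l * (4 * r + 2) + l * r"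
        using b c pos by (intro add_mono mult_left_mono) auto
      finally show ?thesis by (simp add: algebra_simps)
    qed
    \<comment> \<open>The larger of \<open>5 * l * r\<close> and \<open>2 * l\<close> is at least
      half of their sum.\<close>
    then have "I \<le> 10 * l * r \<or> I \<le> 4 * l" by argo
    moreover have "I ^ 3 \<le> 1000 * (l * x * y)\<^sup>2" if "I \<le> 10 * l * r"
    proof -
      have "I ^ 3 \<le> (10 * l * r) ^ 3" using that nn by (intro power_mono) auto
      also have "\<dots> = 1000 * l ^ 3 * r ^ 3" by (simp add: power_mult_distrib)
      also have "\<dots> = 1000 * (l * x * y)\<^sup>2"
        using pos unfolding r(2) by (simp add: power2_eq_square power3_eq_cube)
      finally show ?thesis .
    qed
    ultimately show ?thesis by blast
  qed
  then show ?thesis unfolding I_def l_def x_def y_def by linarith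
qed

section \<open>Dyadic decomposition\<close>

lemma sum_card_fibers:
  assumes "finite S" "finite T" "f ` S \<subseteq> T"
  shows "(\<Sum>y\<in>T. card {x \<in> S. f x = y}) = card S"
  using sum.group[OF assms, of "\<lambda>_. 1::nat"] by simp

text \<open>The values of \<open>f\<close> fall into \<open>J\<close> dyadic levels, one of which
  carries at least the average share of the weight \<open>g\<close>.\<close>

lemma dyadic_pigeonhole:
  fixes f :: "'a \<Rightarrow> nat" and g :: "'a \<Rightarrow> real"
  assumes X: "finite X" and f: "\<And>x. x \<in> X \<Longrightarrow> 1 \<le> f x \<and> f x < 2 ^ J"
    and g: "\<And>x. x \<in> X \<Longrightarrow> 0 \<le> g x" and J: "J > 0"
  obtains j where "sum g X \<le> real J * sum g {x \<in> X. 2 ^ j \<le> f x \<and> f x < 2 ^ (j + 1)}"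
proof -
  let ?L = "\<lambda>j. {x \<in> X. 2 ^ j \<le> f x \<and> f x < 2 ^ (j + 1)}"
  have "\<exists>j. 2 ^ j \<le> f x \<and> f x < 2 ^ (j + 1)" if "x \<in> X" for x
    using ex_power_ivl1[of 2 "f x"] f[OF that] by auto
  then obtain v where v: "\<And>x. x \<in> X \<Longrightarrow> 2 ^ v x \<le> f x \<and> f x < 2 ^ (v x + 1)" by metis
  have vJ: "v ` X \<subseteq> {..<J}"
  proof clarify
    fix x assume "x \<in> X"
    then have "(2::nat) ^ v x < 2 ^ J" using v f by (meson le_less_trans)
    then show "v x < J" by simp
  qed
  have "sum g X = (\<Sum>j<J. sum g {x \<in> X. v x = j})"
    using sum.group[OF X _ vJ, of g] by simp
  also have "\<dots> \<le> (\<Sum>j<J. sum g (?L j))"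
    using X v g by (intro sum_mono sum_mono2) auto
  finally have le: "sum g X \<le> (\<Sum>j<J. sum g (?L j))" .
  have "\<exists>j. sum g X \<le> real J * sum g (?L j)"
  proof (rule ccontr)
    assume "\<not> ?thesis"
    then have "\<And>j. sum g (?L j) < sum g X / J" using J by (auto simp: not_le field_simps)
    then have "(\<Sum>j<J. sum g (?L j)) < (\<Sum>j<J. sum g X / J)"
      using J by (intro sum_strict_mono) auto
    then show False using le J by simp
  qed
  then show ?thesis using that by blast
qed

text \<open>On the heaviest dyadic level \<open>f\<close> is known up to a factor 2, so the
  weak-type bound at \<open>t = 2 ^ j\<close> controls that level; passing to the full moment costs
  the factor \<open>J\<close>.\<close>

lemma dyadic_moment_bound:
  fixes f :: "'a \<Rightarrow> nat"
  assumes X: "finite X" and f: "\<And>x. x \<in> X \<Longrightarrow> 1 \<le> f x \<and> f x < 2 ^ J" and J: "J > 0"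
    and K: "\<And>t. t \<ge> 1 \<Longrightarrow> real (card {x \<in> X. t \<le> f x}) * real t ^ p \<le> K"
  shows "(\<Sum>x\<in>X. real (f x) ^ p) \<le> real J * 2 ^ p * K"
proof -
  obtain j where j: "(\<Sum>x\<in>X. real (f x) ^ p) \<le>
      real J * (\<Sum>x\<in>{x \<in> X. 2 ^ j \<le> f x \<and> f x < 2 ^ (j + 1)}. real (f x) ^ p)"
    by (rule dyadic_pigeonhole[where f = f and g = "\<lambda>x. real (f x) ^ p", OF X f _ J]) simp_all
  have "(\<Sum>x\<in>{x \<in> X. 2 ^ j \<le> f x \<and> f x < 2 ^ (j + 1)}. real (f x) ^ p)
      \<le> (\<Sum>x\<in>{x \<in> X. 2 ^ j \<le> f x \<and> f x < 2 ^ (j + 1)}. real (2 ^ (j + 1)) ^ p)"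
    by (intro sum_mono power_mono of_nat_mono) auto
  also have "\<dots> = real (card {x \<in> X. 2 ^ j \<le> f x \<and> f x < 2 ^ (j + 1)}) * real (2 ^ j) ^ p * 2 ^ p"
    by (simp add: power_mult_distrib)
  also have "\<dots> \<le> real (card {x \<in> X. 2 ^ j \<le> f x}) * real (2 ^ j) ^ p * 2 ^ p"
    using X by (intro mult_right_mono of_nat_mono card_mono) auto
  also have "\<dots> \<le> K * 2 ^ p" by (intro mult_right_mono K) auto
  finally have "real J * (\<Sum>x\<in>{x \<in> X. 2 ^ j \<le> f x \<and> f x < 2 ^ (j + 1)}. real (f x) ^ p)
      \<le> real J * (K * 2 ^ p)" by (intro mult_left_mono) auto
  then show ?thesis using j by (simp add: mult_ac)
qed

section \<open>Popular differences of multiplicatively structured sets\<close>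

text \<open>\<open>card (reps B C x)\<close> is the representation function of B - C. Keeping the
  pairs themselves lets the counting arguments be phrased as injections.\<close>

definition reps :: "real set \<Rightarrow> real set \<Rightarrow> real \<Rightarrow> (real \<times> real) set" where
  "reps B C x = {(b, c). b \<in> B \<and> c \<in> C \<and> b - c = x}"

definition diffs :: "real set \<Rightarrow> real set \<Rightarrow> real set" where
  "diffs B C = (\<lambda>(b, c). b - c) ` (B \<times> C)"

lemma finite_diffs [simp]: "finite B \<Longrightarrow> finite C \<Longrightarrow> finite (diffs B C)"
  by (simp add: diffs_def)

lemma finite_reps [simp]:
  assumes "finite B" "finite C" shows "finite (reps B C x)"
  by (rule finite_subset[of _ "B \<times> C"]) (use assms in \<open>auto simp: reps_def\<close>)

lemma reps_eq_fiber: "reps B C x = {p \<in> B \<times> C. (\<lambda>(b, c). b - c) p = x}"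
  by (auto simp: reps_def)

lemma sum_card_reps:
  assumes "finite B" "finite C"
  shows "(\<Sum>x\<in>diffs B C. card (reps B C x)) = card B * card C"
  unfolding reps_eq_fiber using assms
  by (subst sum_card_fibers) (auto simp: diffs_def card_cartesian_product)

lemma card_reps_le:
  assumes "finite B" "finite C"
  shows "card (reps B C x) \<le> card B" "card (reps B C x) \<le> card C"
proof -
  show "card (reps B C x) \<le> card B"
    using assms by (intro card_inj_on_le[of fst]) (auto simp: inj_on_def reps_def)
  show "card (reps B C x) \<le> card C"
    using assms by (intro card_inj_on_le[of snd]) (auto simp: inj_on_def reps_def)
qed

lemma card_reps_pos:
  assumes "finite B" "finite C" "x \<in> diffs B C"
  shows "card (reps B C x) \<ge> 1"
proof -
  have "reps B C x \<noteq> {}" using assms(3) by (auto simp: diffs_def reps_def)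
  then show ?thesis using assms by (simp add: Suc_le_eq card_gt_0_iff)
qed

lemma card_Sigma_ge:
  assumes "finite S" "\<And>x. x \<in> S \<Longrightarrow> finite (F x)" "\<And>x. x \<in> S \<Longrightarrow> n \<le> card (F x)"
  shows "n * card S \<le> card (Sigma S F)"
  using sum_mono[of S "\<lambda>_. n" "\<lambda>x. card (F x)"] assms by (simp add: mult.commute)

text \<open>If x = b - c and b = q r, then the line y = q z - c passes through the point (r, x).
  This yields at least \<open>s * t * card S\<close> incidences between at most |Q| |C| lines and
  the grid \<open>R \<times> S\<close>, to which Szemeredi--Trotter applies.\<close>

lemma card_rich_differences_le:
  assumes fin: "finite B" "finite C" "finite Q" "finite R" and S: "S \<subseteq> diffs B C"
    and Q0: "0 \<notin> Q"
    and s: "\<And>b. b \<in> B \<Longrightarrow> s \<le> card {(q, r). q \<in> Q \<and> r \<in> R \<and> q * r = b}" and sR: "s \<le> card R"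
    and t: "\<And>x. x \<in> S \<Longrightarrow> t \<le> card (reps B C x)"
  shows "real (card S) * (real s * real t) ^ 3 \<le> 1000 * (real (card Q) * real (card R) * real (card C))\<^sup>2"
proof (cases "S = {}")
  case True
  then show ?thesis by simp
next
  case False
  have finS: "finite S" using fin by (intro finite_subset[OF S]) simp
  define F where "F = (\<lambda>b. {(q, r). q \<in> Q \<and> r \<in> R \<and> q * r = b})"
  have finF: "finite (F b)" for b
    by (rule finite_subset[of _ "Q \<times> R"]) (use fin in \<open>auto simp: F_def\<close>)
  have sF: "s \<le> card (F b)" if "b \<in> B" for b using s[OF that] by (simp add: F_def)
  define L where "L = (\<lambda>(q, c). (q, - c)) ` (Q \<times> C)"
  have finL: "finite L" using fin by (simp add: L_def)
  have nzL: "fst l \<noteq> 0" if "l \<in> L" for l using that Q0 by (auto simp: L_def)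
  have cardL: "card L \<le> card Q * card C"
    unfolding L_def card_cartesian_product[symmetric] using fin by (intro card_image_le) simp
  let ?T = "Sigma S (\<lambda>x. Sigma (reps B C x) (\<lambda>p. F (fst p)))"
  have "s * t \<le> card (Sigma (reps B C x) (\<lambda>p. F (fst p)))" if "x \<in> S" for x
  proof -
    have "s * t \<le> s * card (reps B C x)" using t[OF that] by simp
    also have "\<dots> \<le> card (Sigma (reps B C x) (\<lambda>p. F (fst p)))"
      by (intro card_Sigma_ge finite_reps fin finF sF) (auto simp: reps_def)
    finally show ?thesis .
  qed
  then have "s * t * card S \<le> card ?T"
    using fin finS finF by (intro card_Sigma_ge) auto
  also have "card ?T \<le> card (incidences R S L)"
  proof (rule card_inj_on_le)
    let ?h = "\<lambda>(x, (b, c), (q, r)). ((q, - c), r)"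
    show "inj_on ?h ?T" by (auto simp: inj_on_def reps_def F_def)
    show "?h ` ?T \<subseteq> incidences R S L"
      by (auto simp: reps_def F_def incidences_def L_def)
    show "finite (incidences R S L)" using fin finL by simp
  qed
  finally have inc: "s * t * card S \<le> card (incidences R S L)" .
  define n q r c where "n = real (card S)" and "q = real (card Q)" and "r = real (card R)"
    and "c = real (card C)"
  have n: "n > 0" using False finS by (simp add: n_def card_gt_0_iff)
  define st where "st = real s * real t"
  have nn: "st \<ge> 0" "q \<ge> 0" "r \<ge> 0" "c \<ge> 0" by (auto simp: st_def q_def r_def c_def)
  have inc': "st * n \<le> real (card (incidences R S L))"
    unfolding st_def n_def of_nat_mult[symmetric] of_nat_le_iff by (rule inc)
  have L': "real (card L) \<le> q * c"
    unfolding q_def c_def of_nat_mult[symmetric] of_nat_le_iff by (rule cardL)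
  consider "real (card (incidences R S L)) ^ 3 \<le> 1000 * (real (card L) * r * n)\<^sup>2"
    | "card (incidences R S L) \<le> 4 * card L"
    using szemeredi_trotter_cartesian[OF fin(4) finS finL nzL] by (auto simp: r_def n_def)
  then have "n * st ^ 3 \<le> 1000 * (q * r * c)\<^sup>2"
  proof cases
    case 1
    have "(st * n) ^ 3 \<le> real (card (incidences R S L)) ^ 3"
      using inc' nn n by (intro power_mono) auto
    also note 1
    also have "1000 * (real (card L) * r * n)\<^sup>2 \<le> 1000 * (q * c * r * n)\<^sup>2"
      using L' nn n by (intro mult_left_mono power_mono mult_right_mono) auto
    finally have "n\<^sup>2 * (n * st ^ 3) \<le> n\<^sup>2 * (1000 * (q * r * c)\<^sup>2)"
      by (simp add: power2_eq_square power3_eq_cube mult_ac)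
    then show ?thesis using n by simp
  next
    \<comment> \<open>Here \<open>st * n \<le> 4 * (q * c)\<close>. The remaining factor
      \<open>st^2\<close> is estimated trivially: s t is at most s |B|, hence at most |Q| |R|, and
      also at most |R| |C|.\<close>
    case 2
    obtain x where x: "x \<in> S" using False by blast
    have tB: "t \<le> card B" and tC: "t \<le> card C"
      using t[OF x] card_reps_le[OF fin(1,2), of x] by linarith+
    have "s * card B \<le> card (Sigma B F)"
      by (intro card_Sigma_ge fin finF sF)
    also have "\<dots> \<le> card (Q \<times> R)"
      using fin by (intro card_inj_on_le[of snd]) (auto simp: F_def inj_on_def)
    finally have sB: "s * card B \<le> card Q * card R" by (simp add: card_cartesian_product)
    have "(s * t) * (s * t) \<le> (s * card B) * (s * card C)"
      using tB tC by (intro mult_mono) auto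
    also have "\<dots> \<le> (card Q * card R) * (card R * card C)"
      by (rule mult_le_mono[OF sB mult_le_mono1[OF sR]])
    finally have "real ((s * t) * (s * t)) \<le> real ((card Q * card R) * (card R * card C))"
      by (rule of_nat_mono)
    then have a: "st\<^sup>2 \<le> q * r * (r * c)"
      by (simp add: st_def q_def r_def c_def power2_eq_square)
    have "real (card (incidences R S L)) \<le> real (4 * card L)" using 2 by (rule of_nat_mono)
    then have b: "st * n \<le> 4 * (q * c)" using inc' L' by simp
    have "n * st ^ 3 = (st * n) * st\<^sup>2" by (simp add: power2_eq_square power3_eq_cube)
    also have "\<dots> \<le> (4 * (q * c)) * (q * r * (r * c))"
      using nn by (intro mult_mono[OF b a]) auto
    also have "\<dots> = 4 * (q * r * c)\<^sup>2" by (simp add: power2_eq_square)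
    also have "\<dots> \<le> 1000 * (q * r * c)\<^sup>2" by simp
    finally show ?thesis .
  qed
  then show ?thesis by (simp add: n_def q_def r_def c_def st_def)
qed

text \<open>The number of differences with at least \<open>t\<close> representations decays like
  \<open>1 / t ^ 3\<close>, which is exactly the rate at which a third moment loses only a constant
  times \<open>J\<close>.\<close>

lemma third_moment_reps_le:
  assumes fin: "finite B" "finite C" "finite Q" "finite R" and Q0: "0 \<notin> Q"
    and s: "\<And>b. b \<in> B \<Longrightarrow> s \<le> card {(q, r). q \<in> Q \<and> r \<in> R \<and> q * r = b}" and sR: "s \<le> card R"
    and s0: "s > 0" and J: "J > 0" "card C < 2 ^ J"
  shows "(\<Sum>x\<in>diffs B C. real (card (reps B C x)) ^ 3)
    \<le> real J * 2 ^ 3 * (1000 * (real (card Q) * real (card R) * real (card C))\<^sup>2 / real s ^ 3)"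
proof (rule dyadic_moment_bound[OF _ _ J(1)])
  show "finite (diffs B C)" using fin by simp
  show "1 \<le> card (reps B C x) \<and> card (reps B C x) < 2 ^ J" if "x \<in> diffs B C" for x
    using card_reps_pos[OF fin(1,2) that] card_reps_le(2)[OF fin(1,2), of x] J by linarith
  fix t :: nat
  let ?S = "{x \<in> diffs B C. t \<le> card (reps B C x)}"
  have "real (card ?S) * (real s * real t) ^ 3 \<le> 1000 * (real (card Q) * real (card R) * real (card C))\<^sup>2"
    by (rule card_rich_differences_le[OF fin _ Q0 s sR]) auto
  then show "real (card ?S) * real t ^ 3
      \<le> 1000 * (real (card Q) * real (card R) * real (card C))\<^sup>2 / real s ^ 3"
    using s0 by (simp add: field_simps power_mult_distrib)
qed

text \<open>If N differences have at least t representations, then N t^2 is the geometric mean of N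
  t and N t^3. The first is at most the number of all pairs, the second is bounded by
  incidences.\<close>

lemma second_moment_reps_le:
  assumes fin: "finite B" "finite C" "finite Q" "finite R" and Q0: "0 \<notin> Q"
    and s: "\<And>b. b \<in> B \<Longrightarrow> s \<le> card {(q, r). q \<in> Q \<and> r \<in> R \<and> q * r = b}" and sR: "s \<le> card R"
    and s0: "s > 0" and J: "J > 0" "card C < 2 ^ J"
  shows "(\<Sum>x\<in>diffs B C. (real (card (reps B C x)))\<^sup>2)
    \<le> real J * 2\<^sup>2 * sqrt (real (card B) * real (card C) *
        (1000 * (real (card Q) * real (card R) * real (card C))\<^sup>2 / real s ^ 3))"
proof (rule dyadic_moment_bound[OF _ _ J(1)])
  show "finite (diffs B C)" using fin by simp
  show "1 \<le> card (reps B C x) \<and> card (reps B C x) < 2 ^ J" if "x \<in> diffs B C" for x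
    using card_reps_pos[OF fin(1,2) that] card_reps_le(2)[OF fin(1,2), of x] J by linarith
  fix t :: nat
  let ?S = "{x \<in> diffs B C. t \<le> card (reps B C x)}"
  define K where "K = 1000 * (real (card Q) * real (card R) * real (card C))\<^sup>2 / real s ^ 3"
  have "real (card ?S) * (real s * real t) ^ 3 \<le> 1000 * (real (card Q) * real (card R) * real (card C))\<^sup>2"
    by (rule card_rich_differences_le[OF fin _ Q0 s sR]) auto
  then have 3: "real (card ?S) * real t ^ 3 \<le> K"
    unfolding K_def using s0 by (simp add: field_simps power_mult_distrib)
  have "(\<Sum>x\<in>?S. t) \<le> (\<Sum>x\<in>?S. card (reps B C x))" by (rule sum_mono) auto
  also have "\<dots> \<le> (\<Sum>x\<in>diffs B C. card (reps B C x))"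
    using fin by (intro sum_mono2) auto
  finally have "card ?S * t \<le> card B * card C" using sum_card_reps[OF fin(1,2)] by simp
  then have 1: "real (card ?S) * real t \<le> real (card B) * real (card C)"
    unfolding of_nat_mult[symmetric] of_nat_le_iff .
  have "(real (card ?S) * (real t)\<^sup>2)\<^sup>2 = (real (card ?S) * real t) * (real (card ?S) * real t ^ 3)"
    by (simp add: power2_eq_square power3_eq_cube)
  also have "\<dots> \<le> (real (card B) * real (card C)) * K"
    by (rule mult_mono[OF 1 3]) auto
  finally show "real (card ?S) * (real t)\<^sup>2 \<le> sqrt (real (card B) * real (card C) * K)"
    by (rule real_le_rsqrt)
qed

section \<open>The Katz--Koester inequality\<close>

lemma card_translate_inter_eq_card_reps:
  assumes "finite B"
  shows "card {b \<in> B. b + x \<in> B} = card (reps B B x)"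
  by (rule bij_betw_same_card[of "\<lambda>b. (b + x, b)"])
     (auto simp: bij_betw_def inj_on_def reps_def image_def)

text \<open>A coincidence b - c = b' - c' with c, c' in \<open>T x\<close> gives b - b' = c - c' =
  (c + x) - (c' + x), three representations of one difference. Since \<open>x\<close> is recovered
  from c and c + x, no triple is counted for two shifts.\<close>

lemma sum_translate_energy_le:
  assumes B: "finite B" and X: "X \<subseteq> diffs B B"
  defines "T \<equiv> \<lambda>x. {b \<in> B. b + x \<in> B}"
  shows "(\<Sum>x\<in>X. \<Sum>y\<in>diffs B (T x). (card (reps B (T x) y))\<^sup>2) \<le> (\<Sum>s\<in>diffs B B. card (reps B B s) ^ 3)"
proof -
  have finX: "finite X" using B by (intro finite_subset[OF X]) simp
  have finT: "finite (T x)" for x using B by (simp add: T_def)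
  let ?U = "Sigma X (\<lambda>x. Sigma (diffs B (T x)) (\<lambda>y. reps B (T x) y \<times> reps B (T x) y))"
  let ?V = "Sigma (diffs B B) (\<lambda>s. reps B B s \<times> reps B B s \<times> reps B B s)"
  have "card ?U \<le> card ?V"
  proof (rule card_inj_on_le)
    let ?h = "\<lambda>(x, y, (b, c), (b', c')). (b - b', (b, b'), (c, c'), (c + x, c' + x :: real))"
    show "inj_on ?h ?U" by (rule inj_onI) (clarsimp simp: reps_def)
    show "?h ` ?U \<subseteq> ?V"
      by (auto simp: reps_def diffs_def T_def image_def algebra_simps)
    show "finite ?V" using B by auto
  qed
  moreover have "card ?U = (\<Sum>x\<in>X. \<Sum>y\<in>diffs B (T x). (card (reps B (T x) y))\<^sup>2)"
    using B finT finX by (simp add: card_cartesian_product power2_eq_square)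
  moreover have "card ?V = (\<Sum>s\<in>diffs B B. card (reps B B s) ^ 3)"
    using B by (simp add: card_cartesian_product power3_eq_cube mult.assoc)
  ultimately show ?thesis by simp
qed

text \<open>For w in \<open>diffs B (T x)\<close> and b - c = x with b, c in \<open>B\<close>, the
  identity w - b = (w - x) - c is a coincidence between two differences of \<open>D\<close> and
  \<open>B\<close>. Each \<open>x\<close> in \<open>X\<close> offers at least \<open>t\<close>
  choices of (b, c).\<close>

lemma sum_translate_differences_le:
  assumes B: "finite B" and D: "finite D" "diffs B B \<subseteq> D" and X: "X \<subseteq> diffs B B"
    and t: "\<And>x. x \<in> X \<Longrightarrow> t \<le> card (reps B B x)"
  defines "T \<equiv> \<lambda>x. {b \<in> B. b + x \<in> B}"
  shows "t * (\<Sum>x\<in>X. card (diffs B (T x))) \<le> (\<Sum>y\<in>diffs D B. (card (reps D B y))\<^sup>2)"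
proof -
  have finX: "finite X" using B by (intro finite_subset[OF X]) simp
  have finT: "finite (T x)" for x using B by (simp add: T_def)
  have dD: "b - c \<in> D" if "b \<in> B" "c \<in> B" for b c using that D(2) by (auto simp: diffs_def)
  let ?U = "Sigma X (\<lambda>x. diffs B (T x) \<times> reps B B x)"
  let ?V = "Sigma (diffs D B) (\<lambda>y. reps D B y \<times> reps D B y)"
  have "t * (\<Sum>x\<in>X. card (diffs B (T x))) \<le> (\<Sum>x\<in>X. card (diffs B (T x)) * card (reps B B x))"
    unfolding sum_distrib_left using t by (intro sum_mono) simp
  also have "\<dots> = card ?U"
    using B finT finX by (simp add: card_cartesian_product)
  also have "card ?U \<le> card ?V"
  proof (rule card_inj_on_le)
    \<comment> \<open>If \<open>w = b' - b\<close> with \<open>b, b + x \<in> B\<close> then both \<open>w\<close> and \<open>w - x = b' - (b + x)\<close> lie in \<open>D\<close>.\<close>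
    let ?h = "\<lambda>(x, w, (b, c)). (w - b, (w, b), (w - x :: real, c))"
    show "inj_on ?h ?U" by (rule inj_onI) (clarsimp simp: reps_def)
    show "?h ` ?U \<subseteq> ?V"
    proof (rule image_subsetI)
      fix u assume "u \<in> ?U"
      then obtain x w b c where u: "u = (x, w, b, c)" and x: "x \<in> X" "w \<in> diffs B (T x)" "(b, c) \<in> reps B B x"
        by auto
      then obtain b' b0 where w: "w = b' - b0" "b' \<in> B" "b0 \<in> B" "b0 + x \<in> B"
        by (auto simp: diffs_def T_def)
      have "w - x = b' - (b0 + x)" using w by simp
      then have "w \<in> D" "w - x \<in> D" using dD w by metis+
      then show "?h u \<in> ?V"
        unfolding u using x by (auto simp: reps_def diffs_def image_def)
    qed
    show "finite ?V" using B D by auto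
  qed
  also have "card ?V = (\<Sum>y\<in>diffs D B. (card (reps D B y))\<^sup>2)"
    using B D by (simp add: card_cartesian_product power2_eq_square)
  finally show ?thesis .
qed

text \<open>Cauchy--Schwarz is used twice: for fixed \<open>x\<close>, on the pairs of
  \<open>B \<times> T x\<close> distributed over their differences, and then on the sum over
  \<open>X\<close>. The sum of energies and the sum of difference set sizes are bounded by the two
  preceding injections.\<close>

lemma katz_koester_energy_inequality:
  assumes B: "finite B" and D: "finite D" "diffs B B \<subseteq> D" and X: "X \<subseteq> diffs B B"
    and t: "\<And>x. x \<in> X \<Longrightarrow> t \<le> card (reps B B x)"
  shows "real t * (real (card B) * (\<Sum>x\<in>X. real (card (reps B B x))))\<^sup>2
    \<le> (\<Sum>s\<in>diffs B B. real (card (reps B B s)) ^ 3) * (\<Sum>y\<in>diffs D B. (real (card (reps D B y)))\<^sup>2)"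
proof -
  define T where "T = (\<lambda>x. {b \<in> B. b + x \<in> B})"
  have finX: "finite X" using B by (intro finite_subset[OF X]) simp
  have finT: "finite (T x)" for x using B by (simp add: T_def)
  define e where "e = (\<lambda>x. \<Sum>y\<in>diffs B (T x). (real (card (reps B (T x) y)))\<^sup>2)"
  define w where "w = (\<lambda>x. real (card (diffs B (T x))))"
  have nn: "e x \<ge> 0" "w x \<ge> 0" for x by (auto simp: e_def w_def intro: sum_nonneg)
  have cs: "real (card B) * real (card (reps B B x)) \<le> sqrt (e x) * sqrt (w x)" for x
  proof -
    have "(\<Sum>y\<in>diffs B (T x). card (reps B (T x) y)) = card B * card (reps B B x)"
      using sum_card_reps[OF B finT[of x]] card_translate_inter_eq_card_reps[OF B, of x]
      by (simp add: T_def)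
    then have "(real (card B) * real (card (reps B B x)))\<^sup>2 = (\<Sum>y\<in>diffs B (T x). real (card (reps B (T x) y)))\<^sup>2"
      by (metis of_nat_mult of_nat_sum)
    also have "\<dots> \<le> e x * w x" unfolding e_def w_def by (rule sum_squared_le_sum_of_squares)
    finally show ?thesis by (simp add: real_le_rsqrt flip: real_sqrt_mult)
  qed
  have "real (card B) * (\<Sum>x\<in>X. real (card (reps B B x))) \<le> (\<Sum>x\<in>X. sqrt (e x) * sqrt (w x))"
    unfolding sum_distrib_left by (intro sum_mono cs)
  then have "(real (card B) * (\<Sum>x\<in>X. real (card (reps B B x))))\<^sup>2 \<le> (\<Sum>x\<in>X. sqrt (e x) * sqrt (w x))\<^sup>2"
    by (intro power_mono mult_nonneg_nonneg sum_nonneg) auto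
  also have "\<dots> \<le> (\<Sum>x\<in>X. (sqrt (e x))\<^sup>2) * (\<Sum>x\<in>X. (sqrt (w x))\<^sup>2)"
    by (rule Cauchy_Schwarz_ineq_sum)
  also have "\<dots> = (\<Sum>x\<in>X. e x) * (\<Sum>x\<in>X. w x)" using nn by simp
  finally have "real t * (real (card B) * (\<Sum>x\<in>X. real (card (reps B B x))))\<^sup>2
      \<le> real t * ((\<Sum>x\<in>X. e x) * (\<Sum>x\<in>X. w x))" by (rule mult_left_mono) simp
  also have "\<dots> = (\<Sum>x\<in>X. e x) * (real t * (\<Sum>x\<in>X. w x))" by simp
  also have "\<dots> \<le> (\<Sum>s\<in>diffs B B. real (card (reps B B s)) ^ 3) * (\<Sum>y\<in>diffs D B. (real (card (reps D B y)))\<^sup>2)"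
  proof (rule mult_mono)
    have "real (\<Sum>x\<in>X. \<Sum>y\<in>diffs B (T x). (card (reps B (T x) y))\<^sup>2) \<le> real (\<Sum>s\<in>diffs B B. card (reps B B s) ^ 3)"
      unfolding T_def by (rule of_nat_mono[OF sum_translate_energy_le[OF B X]])
    then show "(\<Sum>x\<in>X. e x) \<le> (\<Sum>s\<in>diffs B B. real (card (reps B B s)) ^ 3)"
      by (simp add: e_def)
    have "real (t * (\<Sum>x\<in>X. card (diffs B (T x)))) \<le> real (\<Sum>y\<in>diffs D B. (card (reps D B y))\<^sup>2)"
      unfolding T_def by (rule of_nat_mono[OF sum_translate_differences_le[OF B D X t]])
    then show "real t * (\<Sum>x\<in>X. w x) \<le> (\<Sum>y\<in>diffs D B. (real (card (reps D B y)))\<^sup>2)"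
      by (simp add: w_def)
  qed (auto intro!: sum_nonneg mult_nonneg_nonneg nn)
  finally show ?thesis .
qed

section \<open>Popular ratios\<close>

text \<open>The summand is the additive energy of A and x A. The sum is treated as a second moment,
  over pairs (x, y), of the number of representations y = b + x c, again as the geometric mean of a
  trivial bound and an incidence bound.\<close>

lemma sum_dilate_energy_le:
  fixes A M :: "real set"
  assumes A: "finite A" and M: "finite M" "0 \<notin> M" "card M \<le> (card A)\<^sup>2"
    and J: "J > 0" "card A < 2 ^ J"
  shows "(\<Sum>x\<in>M. real (card {((b, c), (b', c')). b \<in> A \<and> c \<in> A \<and> b' \<in> A \<and> c' \<in> A \<and> b - c = x * (b' - c')}))
    \<le> real J * 2\<^sup>2 * sqrt (real (card M) * (1000 * real (card A) ^ 6))"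
proof -
  define F where "F = (\<lambda>(x, y). {(b, c). b \<in> A \<and> c \<in> A \<and> b + x * c = y})"
  define Y where "Y = (\<lambda>x. (\<lambda>(b, c). b + x * c) ` (A \<times> A))"
  have finF: "finite (F z)" for z
    by (rule finite_subset[of _ "A \<times> A"]) (use A in \<open>auto simp: F_def split: prod.splits\<close>)
  have finY: "finite (Y x)" for x using A by (simp add: Y_def)
  let ?Z = "Sigma M Y"
  have finZ: "finite ?Z" using M finY by simp
  have Fge: "1 \<le> card (F z)" if "z \<in> ?Z" for z
  proof -
    have "F z \<noteq> {}" using that by (auto simp: F_def Y_def)
    then show ?thesis using finF by (simp add: Suc_le_eq card_gt_0_iff)
  qed
  have Fle: "card (F z) \<le> card A" for z
    using A by (intro card_inj_on_le[of snd]) (auto simp: inj_on_def F_def split: prod.splits)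
  have E: "card {((b, c), (b', c')). b \<in> A \<and> c \<in> A \<and> b' \<in> A \<and> c' \<in> A \<and> b - c = x * (b' - c')}
      \<le> (\<Sum>y\<in>Y x. (card (F (x, y)))\<^sup>2)" (is "card ?Q \<le> _") for x
  proof -
    have "card ?Q \<le> card (Sigma (Y x) (\<lambda>y. F (x, y) \<times> F (x, y)))"
    proof (rule card_inj_on_le)
      \<comment> \<open>Rewriting b - c = x (b' - c') as b + x c' = c + x b' exhibits two
        representations of the same y.\<close>
      let ?h = "\<lambda>((b, c), (b', c')). (b + x * c', (b, c'), (c, b'))"
      show "inj_on ?h ?Q" by (auto simp: inj_on_def)
      show "?h ` ?Q \<subseteq> Sigma (Y x) (\<lambda>y. F (x, y) \<times> F (x, y))"
        by (auto simp: F_def Y_def image_def algebra_simps)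
      show "finite (Sigma (Y x) (\<lambda>y. F (x, y) \<times> F (x, y)))" using finF finY by auto
    qed
    then show ?thesis using finF finY by (simp add: card_cartesian_product power2_eq_square)
  qed
  have "(\<Sum>x\<in>M. real (card {((b, c), (b', c')). b \<in> A \<and> c \<in> A \<and> b' \<in> A \<and> c' \<in> A \<and> b - c = x * (b' - c')}))
      \<le> (\<Sum>x\<in>M. real (\<Sum>y\<in>Y x. (card (F (x, y)))\<^sup>2))"
    by (intro sum_mono of_nat_mono E)
  also have "\<dots> = (\<Sum>z\<in>?Z. (real (card (F z)))\<^sup>2)"
    using M finY by (simp add: sum.Sigma split_def)
  also have "\<dots> \<le> real J * 2\<^sup>2 * sqrt (real (card M) * (1000 * real (card A) ^ 6))"
  proof (rule dyadic_moment_bound[OF finZ _ J(1)])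
    show "1 \<le> card (F z) \<and> card (F z) < 2 ^ J" if "z \<in> ?Z" for z
      using Fge[OF that] Fle[of z] J by linarith
    fix k :: nat assume k: "k \<ge> 1"
    let ?S = "{z \<in> ?Z. k \<le> card (F z)}"
    define a m n where "a = real (card A)" and "m = real (card M)" and "n = real (card ?S)"
    have finS: "finite ?S" using finZ by simp
    have nn: "a \<ge> 0" "m \<ge> 0" "n \<ge> 0" by (auto simp: a_def m_def n_def)
    have "k * card ?S \<le> card (Sigma ?S F)"
      by (intro card_Sigma_ge finS finF) auto
    also have "\<dots> \<le> card (M \<times> A \<times> A)"
    proof (rule card_inj_on_le)
      show "inj_on (\<lambda>(z, p). (fst z, p)) (Sigma ?S F)" by (auto simp: inj_on_def F_def)
      show "(\<lambda>(z, p). (fst z, p)) ` Sigma ?S F \<subseteq> M \<times> A \<times> A" by (auto simp: F_def)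
      show "finite (M \<times> A \<times> A)" using A M by simp
    qed
    finally have "real (k * card ?S) \<le> real (card (M \<times> A \<times> A))" by (rule of_nat_mono)
    then have 1: "n * real k \<le> m * a\<^sup>2"
      by (simp add: card_cartesian_product n_def m_def a_def power2_eq_square mult_ac)
    \<comment> \<open>A representation y = b + x c is a point (c, b) of \<open>A \<times> A\<close>
      on the line of slope -x and intercept y.\<close>
    define L where "L = (\<lambda>(x, y). (- x, y)) ` ?S"
    have finL: "finite L" using finS by (simp add: L_def)
    have nzL: "fst l \<noteq> 0" if "l \<in> L" for l using that M(2) by (auto simp: L_def)
    have cardL: "card L = card ?S"
      unfolding L_def by (rule card_image) (auto simp: inj_on_def)
    have "k * card ?S \<le> card (Sigma ?S F)"
      by (intro card_Sigma_ge finS finF) auto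
    also have "\<dots> \<le> card (incidences A A L)"
    proof (rule card_inj_on_le)
      let ?h = "\<lambda>((x, y), (b, c)). ((- x, y), c)"
      show "inj_on ?h (Sigma ?S F)" by (auto simp: inj_on_def F_def)
      show "?h ` Sigma ?S F \<subseteq> incidences A A L"
        by (auto simp: F_def incidences_def L_def image_def)
      show "finite (incidences A A L)" using A finL by simp
    qed
    finally have inc: "real (k * card ?S) \<le> real (card (incidences A A L))" by (rule of_nat_mono)
    consider "real (card (incidences A A L)) ^ 3 \<le> 1000 * (n * a * a)\<^sup>2"
      | "card (incidences A A L) \<le> 4 * card L"
      using szemeredi_trotter_cartesian[OF A A finL nzL] by (auto simp: n_def a_def cardL)
    then have 3: "n * real k ^ 3 \<le> 1000 * a ^ 4"
    proof cases
      case 1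
      have "(real k * n) ^ 3 \<le> real (card (incidences A A L)) ^ 3"
        using inc by (intro power_mono) (auto simp: n_def)
      also note 1
      finally have "n\<^sup>2 * (n * real k ^ 3) \<le> n\<^sup>2 * (1000 * a ^ 4)"
        by (simp add: eval_nat_numeral mult_ac)
      then show ?thesis using nn by (cases "n = 0") auto
    next
      case 2
      have "real (card (incidences A A L)) \<le> real (4 * card L)" using 2 by (rule of_nat_mono)
      then have "real k * n \<le> 4 * n" using inc by (simp add: cardL n_def)
      then have "n = 0 \<or> real k \<le> 4"
        using nn(3) mult_right_le_imp_le[of "real k" n 4] by linarith
      then show ?thesis
      proof
        assume "n = 0" then show ?thesis by (simp add: a_def)
      next
        \<comment> \<open>For bounded \<open>k\<close> the trivial count suffices, because
          \<open>card M \<le> (card A)^2\<close> turns it into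
          \<open>n * k \<le> a ^ 4\<close>.\<close>
        assume k4: "real k \<le> 4"
        have "real (card M) \<le> real ((card A)\<^sup>2)" using M(3) by (rule of_nat_mono)
        then have "m * a\<^sup>2 \<le> a\<^sup>2 * a\<^sup>2" by (intro mult_right_mono) (auto simp: m_def a_def)
        then have nk: "n * real k \<le> a ^ 4" using 1 by (simp add: eval_nat_numeral mult_ac)
        have "n * real k ^ 3 = (n * real k) * (real k)\<^sup>2" by (simp add: eval_nat_numeral)
        also have "\<dots> \<le> a ^ 4 * 4\<^sup>2"
          using k4 by (intro mult_mono[OF nk] power_mono) auto
        also have "\<dots> \<le> 1000 * a ^ 4" by simp
        finally show ?thesis .
      qed
    qed
    have "(n * (real k)\<^sup>2)\<^sup>2 = (n * real k) * (n * real k ^ 3)" by (simp add: eval_nat_numeral)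
    also have "\<dots> \<le> (m * a\<^sup>2) * (1000 * a ^ 4)"
      using nn by (intro mult_mono[OF 1 3]) auto
    also have "\<dots> = m * (1000 * a ^ 6)" by (simp add: eval_nat_numeral)
    finally show "real (card ?S) * (real k)\<^sup>2 \<le> sqrt (real (card M) * (1000 * real (card A) ^ 6))"
      unfolding a_def m_def n_def by (rule real_le_rsqrt)
  qed
  finally show ?thesis .
qed

section \<open>Ratios with many representations\<close>

lemma finite_prod_diffset: "finite A \<Longrightarrow> finite (prod_diffset A)"
  by (rule finite_subset[of _ "(\<lambda>(a, b, c). a * (b - c)) ` (A \<times> A \<times> A)"])
     (auto simp: prod_diffset_def image_def)

text \<open>Cauchy--Schwarz gives at least |A|^6 / |P| solutions of a(b - c) = a'(b' - c'). A ratio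
  x = a'/a accounts for at most its number of representations times the energy of A and x A. One
  dyadic level of the representation number is kept and the bound for the sum of energies is
  inserted.\<close>

lemma popular_ratios_exist:
  assumes A: "finite A" "0 \<notin> A" and J: "J > 0" "card A < 2 ^ J"
  obtains M \<tau> where "finite M" "0 \<notin> M" "\<tau> \<le> card A"
    "\<forall>x\<in>M. \<tau> \<le> card {r \<in> A. x * r \<in> A}"
    "real (card A) ^ 6 \<le> 64000 * real J ^ 4 * (real (card (prod_diffset A)))\<^sup>2 * (real \<tau>)\<^sup>2 * real (card M)"
proof (cases "A = {}")
  case True
  then show ?thesis using that[of "{}" 0] by simp
next
  case False
  define M0 where "M0 = (\<lambda>(a, a'). a' / a) ` (A \<times> A)"
  define \<rho> where "\<rho> = (\<lambda>x. {r \<in> A. x * r \<in> A})"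
  define Q where "Q = (\<lambda>x. {((b, c), (b', c')). b \<in> A \<and> c \<in> A \<and> b' \<in> A \<and> c' \<in> A \<and> b - c = x * (b' - c')})"
  have finM0: "finite M0" using A by (simp add: M0_def)
  have M00: "0 \<notin> M0" using A by (auto simp: M0_def)
  have fin\<rho>: "finite (\<rho> x)" for x using A by (simp add: \<rho>_def)
  have finQ: "finite (Q x)" for x
    by (rule finite_subset[of _ "(A \<times> A) \<times> (A \<times> A)"]) (use A in \<open>auto simp: Q_def\<close>)
  have \<rho>le: "card (\<rho> x) \<le> card A" for x using A by (intro card_mono) (auto simp: \<rho>_def)
  have \<rho>ge: "card (\<rho> x) \<ge> 1" if "x \<in> M0" for x
  proof -
    obtain a a' where a: "a \<in> A" "a' \<in> A" "x = a' / a" using \<open>x \<in> M0\<close> by (auto simp: M0_def)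
    then have "a \<noteq> 0" using A(2) by blast
    then have "a \<in> \<rho> x" using a by (simp add: \<rho>_def)
    then show ?thesis using fin\<rho>[of x] by (metis card_gt_0_iff empty_iff Suc_le_eq One_nat_def)
  qed
  let ?P = "prod_diffset A"
  let ?h = "\<lambda>(a, b, c). a * (b - c :: real)"
  let ?N = "\<lambda>p. {u \<in> A \<times> A \<times> A. ?h u = p}"
  have finP: "finite ?P" using A by (simp add: finite_prod_diffset)
  have finN: "finite (?N p)" for p using A by simp
  have "card (A \<times> A \<times> A) = (\<Sum>p\<in>?P. card (?N p))"
    using A finP by (intro sum_card_fibers[symmetric]) (auto simp: prod_diffset_def)
  then have "(real (card A) ^ 3)\<^sup>2 = (\<Sum>p\<in>?P. real (card (?N p)))\<^sup>2"
    by (simp add: card_cartesian_product power3_eq_cube mult.assoc flip: of_nat_sum of_nat_mult)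
  also have "\<dots> \<le> (\<Sum>p\<in>?P. (real (card (?N p)))\<^sup>2) * card ?P"
    by (rule sum_squared_le_sum_of_squares)
  finally have cs: "real (card A) ^ 6 \<le> (\<Sum>p\<in>?P. (real (card (?N p)))\<^sup>2) * card ?P" by simp
  have "card (Sigma ?P (\<lambda>p. ?N p \<times> ?N p)) \<le> card (Sigma M0 (\<lambda>x. \<rho> x \<times> Q x))"
  proof (rule card_inj_on_le)
    \<comment> \<open>Injectivity: \<open>p\<close> is recovered as a(b - c), and a' as the ratio
      times a.\<close>
    let ?g = "\<lambda>(p :: real, (a, b, c), (a', b', c')). (a' / a :: real, a, ((b :: real, c :: real), (b' :: real, c' :: real)))"
    show "inj_on ?g (Sigma ?P (\<lambda>p. ?N p \<times> ?N p))"
    proof (rule inj_onI, goal_cases)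
      case (1 u v)
      then show ?case using A(2) by (cases u; cases v) (auto simp: divide_simps split: if_splits)
    qed
    show "?g ` Sigma ?P (\<lambda>p. ?N p \<times> ?N p) \<subseteq> Sigma M0 (\<lambda>x. \<rho> x \<times> Q x)"
    proof (rule image_subsetI)
      fix u assume "u \<in> Sigma ?P (\<lambda>p. ?N p \<times> ?N p)"
      then obtain p a b c a' b' c' where u: "u = (p, (a, b, c), (a', b', c'))"
        and m: "a \<in> A" "b \<in> A" "c \<in> A" "a' \<in> A" "b' \<in> A" "c' \<in> A"
        and e: "a * (b - c) = a' * (b' - c')" by auto
      have "a \<noteq> 0" using m A(2) by blast
      then have "b - c = a' / a * (b' - c')" using e by (simp add: field_simps)
      then show "?g u \<in> Sigma M0 (\<lambda>x. \<rho> x \<times> Q x)"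
        unfolding u using m \<open>a \<noteq> 0\<close> by (auto simp: M0_def \<rho>_def Q_def)
    qed
    show "finite (Sigma M0 (\<lambda>x. \<rho> x \<times> Q x))" using finM0 fin\<rho> finQ by auto
  qed
  then have "real (card (Sigma ?P (\<lambda>p. ?N p \<times> ?N p))) \<le> real (card (Sigma M0 (\<lambda>x. \<rho> x \<times> Q x)))"
    by (rule of_nat_mono)
  then have en: "(\<Sum>p\<in>?P. (real (card (?N p)))\<^sup>2) \<le> (\<Sum>x\<in>M0. real (card (\<rho> x)) * real (card (Q x)))"
    using finP finN finM0 fin\<rho> finQ by (simp add: card_cartesian_product power2_eq_square)
  obtain j where j: "(\<Sum>x\<in>M0. real (card (\<rho> x)) * real (card (Q x))) \<le>
      real J * (\<Sum>x\<in>{x \<in> M0. 2 ^ j \<le> card (\<rho> x) \<and> card (\<rho> x) < 2 ^ (j + 1)}. real (card (\<rho> x)) * real (card (Q x)))"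
  proof (rule dyadic_pigeonhole[OF finM0 _ _ J(1), of "\<lambda>x. card (\<rho> x)" "\<lambda>x. real (card (\<rho> x)) * real (card (Q x))"])
    show "1 \<le> card (\<rho> x) \<and> card (\<rho> x) < 2 ^ J" if "x \<in> M0" for x
      using \<rho>ge[OF that] \<rho>le[of x] J by linarith
  qed auto
  define M where "M = {x \<in> M0. 2 ^ j \<le> card (\<rho> x) \<and> card (\<rho> x) < 2 ^ (j + 1)}"
  define \<tau> :: nat where "\<tau> = 2 ^ j"
  define a p m t where "a = real (card A)" and "p = real (card ?P)" and "m = real (card M)" and "t = real \<tau>"
  have a: "a > 0" using A False by (simp add: a_def card_gt_0_iff)
  have finM: "finite M" and M0': "0 \<notin> M" using finM0 M00 by (auto simp: M_def)
  have "card M \<le> card M0" using finM0 by (intro card_mono) (auto simp: M_def)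
  also have "\<dots> \<le> card (A \<times> A)" unfolding M0_def using A by (intro card_image_le) simp
  finally have cardM: "card M \<le> (card A)\<^sup>2" by (simp add: card_cartesian_product power2_eq_square)
  have "(\<Sum>x\<in>M. real (card (\<rho> x)) * real (card (Q x))) \<le> (\<Sum>x\<in>M. 2 * t * real (card (Q x)))"
  proof (intro sum_mono mult_right_mono)
    fix x assume "x \<in> M"
    then have "card (\<rho> x) \<le> 2 * \<tau>" by (simp add: M_def \<tau>_def)
    then have "real (card (\<rho> x)) \<le> real (2 * \<tau>)" by (rule of_nat_mono)
    then show "real (card (\<rho> x)) \<le> 2 * t" by (simp add: t_def)
  qed simp
  also have "\<dots> = 2 * t * (\<Sum>x\<in>M. real (card (Q x)))" by (simp add: sum_distrib_left)
  also have "\<dots> \<le> 2 * t * (real J * 2\<^sup>2 * sqrt (m * (1000 * a ^ 6)))"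
    unfolding Q_def a_def m_def
    by (intro mult_left_mono sum_dilate_energy_le A finM M0' cardM J) (simp add: t_def)
  finally have up: "(\<Sum>x\<in>M. real (card (\<rho> x)) * real (card (Q x))) \<le> 8 * t * real J * sqrt (m * (1000 * a ^ 6))"
    by simp
  have "a ^ 6 \<le> (\<Sum>x\<in>M0. real (card (\<rho> x)) * real (card (Q x))) * p"
    using cs en unfolding a_def p_def by (meson mult_right_mono of_nat_0_le_iff order_trans)
  also have "\<dots> \<le> (real J * (\<Sum>x\<in>M. real (card (\<rho> x)) * real (card (Q x)))) * p"
    using j by (intro mult_right_mono) (auto simp: M_def p_def)
  also have "\<dots> \<le> (real J * (8 * t * real J * sqrt (m * (1000 * a ^ 6)))) * p"
    using up by (intro mult_right_mono mult_left_mono) (auto simp: p_def)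
  \<comment> \<open>Squaring removes the root and produces the constant
    \<open>64000 = 8^2 * 1000\<close>; a factor \<open>a ^ 6\<close> then cancels.\<close>
  finally have "(a ^ 6)\<^sup>2 \<le> ((real J * (8 * t * real J * sqrt (m * (1000 * a ^ 6)))) * p)\<^sup>2"
    using a by (intro power_mono) auto
  also have "\<dots> = 64 * real J ^ 4 * t\<^sup>2 * p\<^sup>2 * (sqrt (m * (1000 * a ^ 6)))\<^sup>2"
    by (simp add: eval_nat_numeral mult_ac)
  also have "(sqrt (m * (1000 * a ^ 6)))\<^sup>2 = m * (1000 * a ^ 6)"
    using a by (simp add: m_def)
  finally have "a ^ 6 * a ^ 6 \<le> a ^ 6 * (64000 * real J ^ 4 * p\<^sup>2 * t\<^sup>2 * m)"
    by (simp add: eval_nat_numeral mult_ac)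
  then have main: "a ^ 6 \<le> 64000 * real J ^ 4 * p\<^sup>2 * t\<^sup>2 * m"
    using a by (subst (asm) mult_le_cancel_left_pos) auto
  show ?thesis
  proof (rule that)
    show "finite M" "0 \<notin> M" by fact+
    \<comment> \<open>An element of \<open>M\<close> is needed to compare \<open>\<tau>\<close> with
      |A|; its existence follows from the lower bound \<open>main\<close>.\<close>
    have "M \<noteq> {}" using main a by (auto simp: m_def)
    then obtain x where "x \<in> M" by blast
    then have "\<tau> \<le> card (\<rho> x)" by (simp add: M_def \<tau>_def)
    then show "\<tau> \<le> card A" using \<rho>le[of x] by linarith
    show "\<forall>x\<in>M. \<tau> \<le> card {r \<in> A. x * r \<in> A}"
      by (simp add: M_def \<tau>_def \<rho>_def)
    show "real (card A) ^ 6 \<le> 64000 * real J ^ 4 * (real (card ?P))\<^sup>2 * (real \<tau>)\<^sup>2 * real (card M)"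
      using main by (simp add: a_def p_def t_def m_def)
  qed
qed

section \<open>The lower bound\<close>

text \<open>Here a, p, m, n stand for |A|, |P|, |M|, |B|, and t, s for the multiplicities of ratios
  and products. Up to constants and powers of J, squaring \<open>kk\<close> and inserting
  \<open>E3\<close> and \<open>E2\<close> gives n^9 s^6 \<le> p^5 m^4 a^3. The ninth power of
  \<open>degrees\<close> with s \<le> a eliminates n and s: t^9 m^5 \<le> p^5 a^6. One more factor t
  \<le> a and the fifth power of \<open>ratios\<close> give a^30 \<le> p^15 a^7.\<close>

lemma exponent_bookkeeping:
  fixes a p m s n t J E2 E3 :: real
  assumes pos: "a > 0" "p > 0" "m > 0" "s > 0" "n > 0" "t \<ge> 0" "J > 0" "E2 \<ge> 0" "E3 \<ge> 0"
    and le: "s \<le> a" "t \<le> a"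
    and ratios: "a ^ 6 \<le> 64000 * J ^ 4 * p\<^sup>2 * t\<^sup>2 * m"
    and degrees: "t * m \<le> 2 * J * s * n"
    and kk: "n ^ 8 \<le> 2 * J ^ 3 * p * (E3 * E2)"
    and E3: "E3 * s ^ 3 \<le> 8000 * J * (m * a * n)\<^sup>2"
    and E2: "E2\<^sup>2 * a \<le> 16000 * J\<^sup>2 * p ^ 3 * n ^ 3"
  shows "a ^ 23 \<le> (64000 ^ 5 * 512 * 4096000000000) * J ^ 39 * p ^ 15"
proof -
  have "(E3 * s ^ 3)\<^sup>2 \<le> (8000 * J * (m * a * n)\<^sup>2)\<^sup>2"
    using E3 pos by (intro power_mono) auto
  then have "(E3 * s ^ 3)\<^sup>2 * (E2\<^sup>2 * a) \<le> (8000 * J * (m * a * n)\<^sup>2)\<^sup>2 * (16000 * J\<^sup>2 * p ^ 3 * n ^ 3)"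
    using pos by (intro mult_mono[OF _ E2]) auto
  then have EE: "(E3 * E2)\<^sup>2 * (s ^ 6 * a) \<le> 1024000000000 * (J ^ 4 * m ^ 4 * a ^ 4 * p ^ 3 * n ^ 7)"
    by (simp add: eval_nat_numeral mult_ac)
  have "(n ^ 8)\<^sup>2 \<le> (2 * J ^ 3 * p * (E3 * E2))\<^sup>2"
    using kk pos by (intro power_mono) auto
  then have "(n ^ 8)\<^sup>2 * (s ^ 6 * a) \<le> (2 * J ^ 3 * p * (E3 * E2))\<^sup>2 * (s ^ 6 * a)"
    using pos by (intro mult_right_mono) auto
  also have "\<dots> = 4 * J ^ 6 * p\<^sup>2 * ((E3 * E2)\<^sup>2 * (s ^ 6 * a))"
    by (simp add: eval_nat_numeral mult_ac)
  also have "\<dots> \<le> 4 * J ^ 6 * p\<^sup>2 * (1024000000000 * (J ^ 4 * m ^ 4 * a ^ 4 * p ^ 3 * n ^ 7))"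
    using pos by (intro mult_left_mono[OF EE]) auto
  finally have "(n ^ 7 * a) * (n ^ 9 * s ^ 6) \<le> (n ^ 7 * a) * (4096000000000 * J ^ 10 * p ^ 5 * m ^ 4 * a ^ 3)"
    by (simp add: eval_nat_numeral mult_ac)
  then have ns: "n ^ 9 * s ^ 6 \<le> 4096000000000 * J ^ 10 * p ^ 5 * m ^ 4 * a ^ 3"
    using pos by (subst (asm) mult_le_cancel_left_pos) auto
  have s3: "s ^ 3 \<le> a ^ 3" using le pos by (intro power_mono) auto
  have "(t * m) ^ 9 \<le> (2 * J * s * n) ^ 9"
    using degrees pos by (intro power_mono) auto
  also have "\<dots> = 512 * J ^ 9 * (s ^ 3 * (n ^ 9 * s ^ 6))"
    by (simp add: eval_nat_numeral mult_ac)
  also have "\<dots> \<le> 512 * J ^ 9 * (a ^ 3 * (4096000000000 * J ^ 10 * p ^ 5 * m ^ 4 * a ^ 3))"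
    using pos by (intro mult_left_mono mult_mono[OF s3 ns]) auto
  finally have "m ^ 4 * (t ^ 9 * m ^ 5) \<le> m ^ 4 * (512 * 4096000000000 * J ^ 19 * p ^ 5 * a ^ 6)"
    by (simp add: eval_nat_numeral mult_ac)
  then have tm: "t ^ 9 * m ^ 5 \<le> 512 * 4096000000000 * J ^ 19 * p ^ 5 * a ^ 6"
    using pos by (subst (asm) mult_le_cancel_left_pos) auto
  have "t * (t ^ 9 * m ^ 5) \<le> a * (512 * 4096000000000 * J ^ 19 * p ^ 5 * a ^ 6)"
    using pos by (intro mult_mono[OF le(2) tm]) auto
  then have tm': "t ^ 10 * m ^ 5 \<le> 512 * 4096000000000 * J ^ 19 * p ^ 5 * a ^ 7"
    by (simp add: eval_nat_numeral mult_ac)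
  have "(a ^ 6) ^ 5 \<le> (64000 * J ^ 4 * p\<^sup>2 * t\<^sup>2 * m) ^ 5"
    using ratios pos by (intro power_mono) auto
  also have "\<dots> = 64000 ^ 5 * J ^ 20 * p ^ 10 * (t ^ 10 * m ^ 5)"
    by (simp add: power_mult_distrib flip: power_mult)
  also have "\<dots> \<le> 64000 ^ 5 * J ^ 20 * p ^ 10 * (512 * 4096000000000 * J ^ 19 * p ^ 5 * a ^ 7)"
    using pos by (intro mult_left_mono[OF tm']) auto
  also have "\<dots> = a ^ 7 * (64000 ^ 5 * 512 * 4096000000000 * (J ^ 20 * J ^ 19) * (p ^ 10 * p ^ 5))"
    by (simp add: mult_ac)
  also have "(a ^ 6) ^ 5 = a ^ 7 * a ^ 23" by (simp flip: power_mult power_add)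
  finally have "a ^ 23 \<le> 64000 ^ 5 * 512 * 4096000000000 * (J ^ 20 * J ^ 19) * (p ^ 10 * p ^ 5)"
    using pos by (subst (asm) mult_le_cancel_left_pos) auto
  then show ?thesis by (simp flip: power_add)
qed

section \<open>Comparing the sizes of A, A - A and A(A - A)\<close>

lemma diffs_eq_diffset: "diffs A A = diffset A"
  by (auto simp: diffs_def diffset_def image_def)

lemma card_diffset_le_card_prod_diffset:
  assumes "finite A" "a \<in> A" "a \<noteq> 0"
  shows "card (diffset A) \<le> card (prod_diffset A)"
proof (rule card_inj_on_le)
  show "inj_on ((*) a) (diffset A)" using assms by (auto simp: inj_on_def)
  show "(*) a ` diffset A \<subseteq> prod_diffset A"
    using assms by (auto simp: diffset_def prod_diffset_def)
qed (use assms in \<open>simp add: finite_prod_diffset\<close>)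

lemma card_le_card_diffset:
  assumes "finite A"
  shows "card A \<le> card (diffset A)"
proof (cases "A = {}")
  case False
  then obtain a where a: "a \<in> A" by blast
  show ?thesis
  proof (rule card_inj_on_le)
    show "inj_on (\<lambda>b. b - a) A" by (simp add: inj_on_def)
    show "(\<lambda>b. b - a) ` A \<subseteq> diffset A" using a by (auto simp: diffset_def)
    show "finite (diffset A)" using assms by (simp flip: diffs_eq_diffset)
  qed
qed simp

text \<open>The rich-difference bounds are applied to two factorisations: elements of
  \<open>B\<close> as products from \<open>M\<close> and \<open>A\<close>, for the third energy of
  \<open>B\<close>, and elements of A - A as products from the inverses of \<open>A\<close> and from
  \<open>P\<close>, for the energy with \<open>B\<close>. The Katz--Koester inequality combines
  them.\<close>

lemma card_pow_23_le:
  assumes A: "finite A" "0 \<notin> A" "A \<noteq> {}" and J: "J > 0" "card A < 2 ^ J"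
  shows "real (card A) ^ 23 \<le> (64000 ^ 5 * 512 * 4096000000000) * real J ^ 39 * real (card (prod_diffset A)) ^ 15"
proof -
  let ?P = "prod_diffset A"
  let ?D = "diffset A"
  obtain a0 where a0: "a0 \<in> A" "a0 \<noteq> 0" using A by blast
  have finP: "finite ?P" using A by (simp add: finite_prod_diffset)
  have finD: "finite ?D" using A by (simp flip: diffs_eq_diffset)
  have DP: "card ?D \<le> card ?P" by (rule card_diffset_le_card_prod_diffset[OF A(1) a0])
  have AP: "card A \<le> card ?P" using card_le_card_diffset[OF A(1)] DP by linarith
  have cA: "card A > 0" using A by (simp add: card_gt_0_iff)
  obtain M \<tau> where M: "finite M" "0 \<notin> M" and \<tau>: "\<tau> \<le> card A"
    "\<forall>x\<in>M. \<tau> \<le> card {r \<in> A. x * r \<in> A}"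
    and ratios: "real (card A) ^ 6 \<le> 64000 * real J ^ 4 * (real (card ?P))\<^sup>2 * (real \<tau>)\<^sup>2 * real (card M)"
    by (rule popular_ratios_exist[OF A(1,2) J]) blast
  have "0 < real (card A) ^ 6" using cA by simp
  then have \<tau>M: "\<tau> > 0" "card M > 0" using ratios by (auto intro: gr0I)

  define F where "F = (\<lambda>b. {(q, r). q \<in> M \<and> r \<in> A \<and> q * r = b})"
  have finF: "finite (F b)" for b
    by (rule finite_subset[of _ "M \<times> A"]) (use A M in \<open>auto simp: F_def\<close>)
  have Fle: "card (F b) \<le> card A" for b
  proof (rule card_inj_on_le)
    show "inj_on snd (F b)" using A(2) by (auto simp: inj_on_def F_def)
    show "snd ` F b \<subseteq> A" by (auto simp: F_def)
  qed (rule A)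
  define A1 where "A1 = {b \<in> A. card (F b) \<ge> 1}"
  have finA1: "finite A1" using A by (simp add: A1_def)
  \<comment> \<open>Double counting of the pairs (x, r) with x r in \<open>A\<close>, first by the
    ratio x and then by the product b = x r.\<close>
  have "\<tau> * card M \<le> card (Sigma M (\<lambda>x. {r \<in> A. x * r \<in> A}))"
    using M A \<tau> by (intro card_Sigma_ge) auto
  also have "\<dots> \<le> card (Sigma A1 F)"
  proof (rule card_inj_on_le)
    show "inj_on (\<lambda>(x, r). (x * r, (x, r))) (Sigma M (\<lambda>x. {r \<in> A. x * r \<in> A}))"
      by (auto simp: inj_on_def)
    have "1 \<le> card (F (x * r))" if "x \<in> M" "r \<in> A" for x r
    proof -
      have "(x, r) \<in> F (x * r)" using that by (simp add: F_def)
      then have "card (F (x * r)) > 0" using finF[of "x * r"] by (auto simp: card_gt_0_iff)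
      then show ?thesis by simp
    qed
    then show "(\<lambda>(x, r). (x * r, (x, r))) ` (Sigma M (\<lambda>x. {r \<in> A. x * r \<in> A})) \<subseteq> Sigma A1 F"
      by (auto simp: F_def A1_def)
    show "finite (Sigma A1 F)" using finA1 finF by auto
  qed
  also have "\<dots> = (\<Sum>b\<in>A1. card (F b))" using finA1 finF by simp
  finally have "real (\<tau> * card M) \<le> real (\<Sum>b\<in>A1. card (F b))" by (rule of_nat_mono)
  then have edges: "real \<tau> * real (card M) \<le> (\<Sum>b\<in>A1. real (card (F b)))" by simp
  obtain i where i: "(\<Sum>b\<in>A1. real (card (F b))) \<le> real J *
      (\<Sum>b\<in>{b \<in> A1. 2 ^ i \<le> card (F b) \<and> card (F b) < 2 ^ (i + 1)}. real (card (F b)))"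
  proof (rule dyadic_pigeonhole[OF finA1 _ _ J(1), of "\<lambda>b. card (F b)" "\<lambda>b. real (card (F b))"])
    show "1 \<le> card (F b) \<and> card (F b) < 2 ^ J" if "b \<in> A1" for b
      using that Fle[of b] J by (simp add: A1_def)
  qed auto
  define B where "B = {b \<in> A1. 2 ^ i \<le> card (F b) \<and> card (F b) < 2 ^ (i + 1)}"
  define s :: nat where "s = 2 ^ i"
  have finB: "finite B" using finA1 by (simp add: B_def)
  have BA: "B \<subseteq> A" by (auto simp: B_def A1_def)
  have sF: "s \<le> card (F b)" if "b \<in> B" for b using that by (simp add: B_def s_def)
  have "(\<Sum>b\<in>B. real (card (F b))) \<le> (\<Sum>b\<in>B. 2 * real s)"
  proof (rule sum_mono)
    fix b assume "b \<in> B"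
    then have "card (F b) \<le> 2 * s" by (simp add: B_def s_def)
    then have "real (card (F b)) \<le> real (2 * s)" by (rule of_nat_mono)
    then show "real (card (F b)) \<le> 2 * real s" by simp
  qed
  then have "real J * (\<Sum>b\<in>B. real (card (F b))) \<le> real J * (\<Sum>b\<in>B. 2 * real s)"
    by (rule mult_left_mono) simp
  then have degrees: "real \<tau> * real (card M) \<le> 2 * real J * real s * real (card B)"
    using edges i by (simp add: B_def mult_ac)
  have "0 < real \<tau> * real (card M)" using \<tau>M by simp
  then have cB: "card B > 0" using degrees by (auto intro: gr0I)
  then have "B \<noteq> {}" by auto
  then obtain b0 where "b0 \<in> B" by blast
  then have sA: "s \<le> card A" using sF[of b0] Fle[of b0] by linarith
  have BJ: "card B < 2 ^ J" using card_mono[OF A(1) BA] J by linarith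

  \<comment> \<open>Pigeonholing the differences of \<open>B\<close> fixes their multiplicity up to
    a factor 2 while keeping at least a \<open>1 / J\<close> share of the pairs in
    \<open>B \<times> B\<close>.\<close>
  obtain k where k: "(\<Sum>x\<in>diffs B B. real (card (reps B B x))) \<le> real J *
      (\<Sum>x\<in>{x \<in> diffs B B. 2 ^ k \<le> card (reps B B x) \<and> card (reps B B x) < 2 ^ (k + 1)}. real (card (reps B B x)))"
  proof (rule dyadic_pigeonhole[OF finite_diffs[OF finB finB] _ _ J(1),
      of "\<lambda>x. card (reps B B x)" "\<lambda>x. real (card (reps B B x))"])
    show "1 \<le> card (reps B B x) \<and> card (reps B B x) < 2 ^ J" if "x \<in> diffs B B" for x
      using card_reps_pos[OF finB finB that] card_reps_le(1)[OF finB finB, of x] BJ by linarith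
  qed auto
  define X where "X = {x \<in> diffs B B. 2 ^ k \<le> card (reps B B x) \<and> card (reps B B x) < 2 ^ (k + 1)}"
  define u :: nat where "u = 2 ^ k"
  define W where "W = (\<Sum>x\<in>X. real (card (reps B B x)))"
  have BD: "diffs B B \<subseteq> ?D" using BA by (auto simp: diffs_def diffset_def)
  have XD: "X \<subseteq> diffs B B" by (auto simp: X_def)
  have "card X \<le> card ?P"
    using card_mono[OF finD order_trans[OF XD BD]] DP by linarith
  then have cX: "real (card X) \<le> real (card ?P)" by (rule of_nat_mono)
  have "W \<le> (\<Sum>x\<in>X. 2 * real u)"
    unfolding W_def
  proof (rule sum_mono)
    fix x assume "x \<in> X"
    then have "card (reps B B x) \<le> 2 * u" by (simp add: X_def u_def)
    then have "real (card (reps B B x)) \<le> real (2 * u)" by (rule of_nat_mono)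
    then show "real (card (reps B B x)) \<le> 2 * real u" by simp
  qed
  also have "\<dots> = 2 * real u * real (card X)" by simp
  also have "\<dots> \<le> 2 * real u * real (card ?P)" using cX by (intro mult_left_mono) auto
  finally have Wu: "W \<le> 2 * real u * real (card ?P)" .
  have "real (\<Sum>x\<in>diffs B B. card (reps B B x)) = real (card B * card B)"
    using sum_card_reps[OF finB finB] by simp
  then have WB: "(real (card B))\<^sup>2 \<le> real J * W"
    using k by (simp add: W_def X_def power2_eq_square)
  define E3 where "E3 = (\<Sum>x\<in>diffs B B. real (card (reps B B x)) ^ 3)"
  define E2 where "E2 = (\<Sum>y\<in>diffs ?D B. (real (card (reps ?D B y)))\<^sup>2)"
  have E0: "E3 \<ge> 0" "E2 \<ge> 0" "W \<ge> 0" by (auto simp: E3_def E2_def W_def intro!: sum_nonneg)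
  have KK: "real u * (real (card B) * W)\<^sup>2 \<le> E3 * E2"
    unfolding E3_def E2_def W_def
    by (rule katz_koester_energy_inequality[OF finB finD BD XD]) (simp add: X_def u_def)
  \<comment> \<open>Three of the four factors |B|^2 are replaced by J W. Of the resulting W^3, two
    factors fit the Katz--Koester inequality and the third supplies the multiplicity
    \<open>u\<close> it requires, so \<open>u\<close> drops out.\<close>
  have "real (card B) ^ 8 = (real (card B))\<^sup>2 * ((real (card B))\<^sup>2) ^ 3" by (simp add: eval_nat_numeral)
  also have "\<dots> \<le> (real (card B))\<^sup>2 * (real J * W) ^ 3"
    using WB by (intro mult_left_mono power_mono) auto
  also have "\<dots> = (real J ^ 3 * (real (card B) * W)\<^sup>2) * W" by (simp add: eval_nat_numeral)
  also have "\<dots> \<le> (real J ^ 3 * (real (card B) * W)\<^sup>2) * (2 * real u * real (card ?P))"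
    using Wu E0 by (intro mult_left_mono) auto
  also have "\<dots> = 2 * real J ^ 3 * real (card ?P) * (real u * (real (card B) * W)\<^sup>2)"
    by (simp add: mult_ac)
  also have "\<dots> \<le> 2 * real J ^ 3 * real (card ?P) * (E3 * E2)"
    using KK by (intro mult_left_mono) auto
  finally have kk: "real (card B) ^ 8 \<le> 2 * real J ^ 3 * real (card ?P) * (E3 * E2)" .

  have s0: "s > 0" by (simp add: s_def)
  have "E3 \<le> real J * 2 ^ 3 * (1000 * (real (card M) * real (card A) * real (card B))\<^sup>2 / real s ^ 3)"
    unfolding E3_def
    by (rule third_moment_reps_le[OF finB finB M(1) A(1) M(2) _ sA s0 J(1) BJ])
       (use sF in \<open>simp add: F_def\<close>)
  then have E3: "E3 * real s ^ 3 \<le> 8000 * real J * (real (card M) * real (card A) * real (card B))\<^sup>2"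
    using s0 by (simp add: field_simps)

  \<comment> \<open>Every difference d equals 1/a times a d, and a d lies in \<open>?P\<close>; each
    \<open>a\<close> in \<open>A\<close> gives its own factorisation.\<close>
  have "card A \<le> card {(q, r). q \<in> inverse ` A \<and> r \<in> ?P \<and> q * r = d}" if d: "d \<in> ?D" for d
  proof (rule card_inj_on_le)
    show "inj_on (\<lambda>a. (inverse a, a * d)) A" by (auto simp: inj_on_def)
    show "(\<lambda>a. (inverse a, a * d)) ` A \<subseteq> {(q, r). q \<in> inverse ` A \<and> r \<in> ?P \<and> q * r = d}"
    proof (rule image_subsetI)
      fix a assume a: "a \<in> A"
      then have "a \<noteq> 0" using A(2) by blast
      then show "(inverse a, a * d) \<in> {(q, r). q \<in> inverse ` A \<and> r \<in> ?P \<and> q * r = d}"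
        using a d by (auto simp: diffset_def prod_diffset_def)
    qed
    show "finite {(q, r). q \<in> inverse ` A \<and> r \<in> ?P \<and> q * r = d}"
      by (rule finite_subset[of _ "inverse ` A \<times> ?P"]) (use A finP in auto)
  qed
  moreover have "finite (inverse ` A)" "0 \<notin> inverse ` A" using A by auto
  ultimately have "E2 \<le> real J * 2\<^sup>2 * sqrt (real (card ?D) * real (card B) *
        (1000 * (real (card (inverse ` A)) * real (card ?P) * real (card B))\<^sup>2 / real (card A) ^ 3))"
    unfolding E2_def by (intro second_moment_reps_le finD finB finP AP cA J(1) BJ)
  also have "card (inverse ` A) = card A" by (rule card_image) (auto simp: inj_on_def)
  finally have "E2\<^sup>2 \<le> (real J * 2\<^sup>2 * sqrt (real (card ?D) * real (card B) *
        (1000 * (real (card A) * real (card ?P) * real (card B))\<^sup>2 / real (card A) ^ 3)))\<^sup>2"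
    using E0 by (intro power_mono) auto
  also have "\<dots> = 16 * (real J)\<^sup>2 * (real (card ?D) * real (card B) *
        (1000 * (real (card A) * real (card ?P) * real (card B))\<^sup>2 / real (card A) ^ 3))"
    unfolding power_mult_distrib by (subst real_sqrt_pow2) auto
  also have "\<dots> = real (card ?D) * (16000 * (real J)\<^sup>2 * (real (card ?P))\<^sup>2 * real (card B) ^ 3 / real (card A))"
    using cA by (simp add: field_simps eval_nat_numeral)
  also have "\<dots> \<le> real (card ?P) * (16000 * (real J)\<^sup>2 * (real (card ?P))\<^sup>2 * real (card B) ^ 3 / real (card A))"
    using DP by (intro mult_right_mono of_nat_mono) auto
  finally have E2: "E2\<^sup>2 * real (card A) \<le> 16000 * (real J)\<^sup>2 * real (card ?P) ^ 3 * real (card B) ^ 3"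
    using cA by (simp add: field_simps eval_nat_numeral)
  show ?thesis
    by (rule exponent_bookkeeping[OF _ _ _ _ _ _ _ E0(2,1) _ _ ratios degrees kk E3 E2])
       (use cA AP \<tau>M cB s0 J sA \<tau>(1) in auto)
qed

section \<open>Removing zero and introducing the logarithm\<close>

lemma prod_diffset_mono: "A \<subseteq> B \<Longrightarrow> prod_diffset A \<subseteq> prod_diffset B"
  by (auto simp: prod_diffset_def)

text \<open>Discarding 0 at most halves |A|, which costs \<open>2 ^ 23\<close>; the number of dyadic
  levels is at most twice the logarithm, which costs \<open>2 ^ 39\<close>. Together they give
  \<open>2 ^ 62\<close>.\<close>

lemma card_pow_23_le_log:
  assumes A: "finite A" "card A \<ge> 2"
  shows "card (prod_diffset A) \<ge> 2"
    and "real (card A) ^ 23 \<le> (64000 ^ 5 * 512 * 4096000000000 * 2 ^ 62) *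
      log 2 (real (card (prod_diffset A))) ^ 39 * real (card (prod_diffset A)) ^ 15"
proof -
  define A' where "A' = A - {0}"
  define p where "p = card (prod_diffset A)"
  have A': "finite A'" "0 \<notin> A'" using A by (auto simp: A'_def)
  have "card A \<le> card A' + 1" unfolding A'_def using A by (cases "0 \<in> A") auto
  then have half: "card A \<le> 2 * card A'" "1 \<le> card A'" using A(2) by linarith+
  then have ne: "A' \<noteq> {}" by auto
  then obtain a where "a \<in> A" "a \<noteq> 0" by (auto simp: A'_def)
  then have cA: "card A \<le> p"
    unfolding p_def
    using card_le_card_diffset[OF A(1)] card_diffset_le_card_prod_diffset[OF A(1)] by fastforce
  then show "card (prod_diffset A) \<ge> 2" using A(2) by (simp add: p_def)
  have p2: "p \<ge> 2" using cA A(2) by linarith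
  define l where "l = log 2 (real p)"
  have l1: "l \<ge> 1" using p2 by (simp add: l_def)
  obtain n where n: "2 ^ n \<le> card A'" "card A' < 2 ^ (n + 1)"
    using ex_power_ivl1[of 2 "card A'"] half by auto
  have "card A' \<le> card A" using A by (intro card_mono) (auto simp: A'_def)
  then have "2 ^ n \<le> p" using n cA by linarith
  then have "real (2 ^ n) \<le> real p" by (rule of_nat_mono)
  then have "real n \<le> l" using p2 by (simp add: l_def le_log_iff powr_realpow)
  \<comment> \<open>The logarithm is at least 1, so it absorbs the additional level.\<close>
  then have J: "real (n + 1) \<le> 2 * l" using l1 by simp
  have "card (prod_diffset A') \<le> p"
    unfolding p_def using A by (intro card_mono finite_prod_diffset prod_diffset_mono) (auto simp: A'_def)
  then have pp: "real (card (prod_diffset A')) \<le> real p" by (rule of_nat_mono)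
  have "real (card A) \<le> real (2 * card A')" using half(1) by (rule of_nat_mono)
  then have "real (card A) ^ 23 \<le> (2 * real (card A')) ^ 23" by (intro power_mono) auto
  also have "\<dots> = 2 ^ 23 * real (card A') ^ 23" by (rule power_mult_distrib)
  also have "\<dots> \<le> 2 ^ 23 * ((64000 ^ 5 * 512 * 4096000000000) * real (n + 1) ^ 39 * real (card (prod_diffset A')) ^ 15)"
    by (intro mult_left_mono card_pow_23_le[OF A' ne _ n(2)]) auto
  also have "\<dots> \<le> 2 ^ 23 * ((64000 ^ 5 * 512 * 4096000000000) * (2 * l) ^ 39 * real p ^ 15)"
    using l1 by (intro mult_left_mono mult_mono power_mono J pp) auto
  also have "\<dots> = (64000 ^ 5 * 512 * 4096000000000 * 2 ^ 62) * l ^ 39 * real p ^ 15"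
    by (simp add: power_mult_distrib)
  finally show "real (card A) ^ 23 \<le> (64000 ^ 5 * 512 * 4096000000000 * 2 ^ 62) *
      log 2 (real (card (prod_diffset A))) ^ 39 * real (card (prod_diffset A)) ^ 15"
    by (simp add: l_def p_def)
qed

theorem theorem1p3:
  shows "\<exists>c>0. \<exists>K>0. \<forall>A :: real set. finite A \<longrightarrow>
     real (card (prod_diffset A)) \<ge>
       K * real (card A) powr (3/2 + 1/34) / (log 2 (real (card (prod_diffset A)))) powr c"
proof -
  define C :: real where "C = 64000 ^ 5 * 512 * 4096000000000 * 2 ^ 62"
  have C: "C > 0" by (simp add: C_def)
  \<comment> \<open>Taking the fifteenth root of \<open>a ^ 23 \<le> C * l ^ 39 * p ^ 15\<close>
    dictates this \<open>K\<close> and the exponent 39/15 = 13/5 of the logarithm.\<close>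
  define K where "K = 1 / C powr (1/15)"
  have "K * real (card A) powr (3/2 + 1/34) / (log 2 (real (card (prod_diffset A)))) powr (13/5)
      \<le> real (card (prod_diffset A))" if A: "finite A" for A :: "real set"
  proof (cases "card A \<ge> 2")
    case False
    \<comment> \<open>Here the logarithm is \<open>0\<close>, since \<open>ln 0 = 0\<close>, and the right-hand side of the bound is a quotient by \<open>0\<close>.\<close>
    have "card A \<le> Suc 0" using False by simp
    then have eq: "\<forall>b\<in>A. \<forall>c\<in>A. b = c" by (rule card_le_Suc0_iff_eq[OF A, THEN iffD1])
    have "prod_diffset A \<subseteq> {0}"
    proof
      fix x assume "x \<in> prod_diffset A"
      then obtain a b c where x: "x = a * (b - c)" "b \<in> A" "c \<in> A" by (auto simp: prod_diffset_def)
      have "b = c" using eq x(2,3) by blast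
      then show "x \<in> {0}" using x(1) by simp
    qed
    then have "prod_diffset A = {} \<or> prod_diffset A = {0}" by blast
    then have "card (prod_diffset A) = 0 \<or> card (prod_diffset A) = 1" by (elim disjE) simp_all
    then have "log 2 (real (card (prod_diffset A))) = 0" by (elim disjE) (simp_all add: log_def)
    then show ?thesis by simp
  next
    case True
    define a p l where "a = real (card A)" and "p = real (card (prod_diffset A))" and "l = log 2 p"
    have p: "p \<ge> 2" using card_pow_23_le_log(1)[OF A True] by (simp add: p_def)
    have l: "l \<ge> 1" using p by (simp add: l_def)
    have a: "a \<ge> 2" using True by (simp add: a_def)
    have main: "a ^ 23 \<le> C * l ^ 39 * p ^ 15"
      using card_pow_23_le_log(2)[OF A True] unfolding a_def l_def p_def C_def .
    \<comment> \<open>Since 3/2 + 1/34 = 26/17 is less than 23/15 and \<open>a\<close> is at least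
      1, the exponent may be raised.\<close>
    have "a powr (3/2 + 1/34) \<le> a powr (23/15)" using a by (intro powr_mono) auto
    also have "\<dots> = (a ^ 23) powr (1/15)"
      using a by (simp add: powr_powr flip: powr_numeral)
    also have "\<dots> \<le> (C * l ^ 39 * p ^ 15) powr (1/15)"
      using main a by (intro powr_mono2) auto
    also have "\<dots> = C powr (1/15) * l powr (13/5) * p"
      using C l p by (simp add: powr_mult powr_powr flip: powr_numeral)
    finally show ?thesis
      using C l unfolding K_def a_def[symmetric] p_def[symmetric] l_def[symmetric]
      by (simp add: field_simps)
  qed
  moreover have "K > 0" using C by (simp add: K_def)
  ultimately show ?thesis by (intro exI[of _ "13/5"] exI[of _ K] conjI) auto
qed

end
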